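(* Let $(M^4,g)$ be an oriented and time-oriented spacetime, $S^2$ an oriented closed spacelike surface in $M$, and $N$ a future-directed timelike vector field on $S$. Let $(\overline M,\overline g)$ be the Minkowski spacetime with natural coordinates $(T,X,Y,Z)$. Suppose moreover that $S$ encloses a spacelike domain $\Omega$ and that $N$ is orthogonal to $\Omega$, the orientation of $S$ being chosen so that $N$, the outward normal of $S$ and the orientation of $S$ form the orientation of $M$. Then, for any 4D isometric matching reference $\varphi$ such that (1) $\varphi_*N=\frac{\partial}{\partial T}$, and (2) $\varphi(S)\subset\mathbb R^3$, we have \[E(S,N,\varphi)=\mathfrak m_{\mathrm{BY}}(\Omega).\]
   Context: Lorentzian metrics have signature $(-,+,+,+)$; everything is smooth. $\mathbb R^3$ denotes a slice $\{T=\text{const}\}$ of Minkowski spacetime; $\partial/\partial T$ is future-directed. A reference is a smooth embedding $\varphi:U\to\overline M$ of an open neighborhood $U$ of $S$ in $M$ that preserves orientation and time orientation. It is a 4D isometric matching reference if $\varphi^*\overline g=g$ at every point of $S$ (on all of $T_pM$, $p\in S$). Let $\omega^a{}_b$ and $\overline\omega^a{}_b$ be the connection forms, with respect to a common local frame $(e_a)$, of the Levi-Civita connections of $g$ and $\varphi^*\overline g$ ($\nabla e_b=\omega^a{}_b\otimes e_a$), let $\iota:S\to M$ be the inclusion, let $i_N$ denote interior multiplication by $N$, and let \[\eta_a{}^b=\tfrac12\sqrt{-\det g}\,g^{b\beta}\epsilon_{a\beta\mu\nu}\,dx^\mu\wedge dx^\nu\] (indices $0,\dots,3$, $\epsilon_{a\beta\mu\nu}$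 totally antisymmetric with $\epsilon_{0123}=1$). For a 4D isometric matching reference the Chen-Nester-Tung quasi-local energy is \[E(S,N,\varphi)=\frac{1}{16\pi}\int_S\iota^*\left[(\omega^a{}_b-\overline\omega^a{}_b)\wedge i_N\eta_a{}^b\right].\] The Brown-York mass is $\mathfrak m_{\mathrm{BY}}(\Omega)=\frac{1}{8\pi}\int_S(k_0-k)\,dV_S$, where $k$ and $k_0$ are the mean curvatures, with respect to the unit outward normal, of $S$ in $\Omega$ and of the isometric embedding of $S$ into $\mathbb R^3$, respectively. Mean curvature is the sum of the principal curvatures, with sign such that round spheres in $\mathbb R^3$ have positive mean curvature.
   Formalization: Assumed in addition: dφ maps the outward normal of S in Ω to a vector pointing out of φ(S) in R^3; without this the claim fails, e.g. φ(t,r,θ)=(t,2−r,Rθ) near the unit sphere, R a reflection. The isometric embedding defining k_0 is φ|_S. *)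

theory Defs
  imports "HOL-Analysis.Analysis"
begin

section \<open>Smooth maps between Euclidean spaces\<close>

primrec Ck_on :: "nat \<Rightarrow> ('a::real_normed_vector \<Rightarrow> 'b::real_normed_vector) \<Rightarrow> 'a set \<Rightarrow> bool" where
  "Ck_on 0 f V \<longleftrightarrow> continuous_on V f"
| "Ck_on (Suc k) f V \<longleftrightarrow>
     (\<forall>x\<in>V. f differentiable (at x)) \<and>
     (\<forall>v. Ck_on k (\<lambda>x. frechet_derivative f (at x) v) V)"

text \<open>Only used on open sets.\<close>

definition smooth_on :: "'a::real_normed_vector set \<Rightarrow> ('a \<Rightarrow> 'b::real_normed_vector) \<Rightarrow> bool" where
  "smooth_on V f \<longleftrightarrow> (\<forall>k. Ck_on k f V)"

definition pd :: "(real^'n \<Rightarrow> 'b::real_normed_vector) \<Rightarrow> 'n \<Rightarrow> real^'n \<Rightarrow> 'b" where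
  "pd f i x = frechet_derivative f (at x) (axis i 1)"


section \<open>Metrics in coordinates\<close>

definition bil :: "real^'n^'n \<Rightarrow> real^'n \<Rightarrow> real^'n \<Rightarrow> real" where
  "bil G v w = v \<bullet> (G *v w)"

definition pullback_metric ::
    "(real^'n \<Rightarrow> real^'n^'n) \<Rightarrow> (real^'k \<Rightarrow> real^'n) \<Rightarrow> real^'k \<Rightarrow> real^'k^'k" where
  "pullback_metric G f y = (\<chi> i j. bil (G (f y)) (pd f i y) (pd f j y))"

text \<open>\<open>christoffel G a m b\<close> is \<open>\<Gamma>\<^sup>a\<^bsub>m b\<^esub>\<close>, so that the connection forms of the coordinate frame are
  \<open>\<omega>\<^sup>a\<^sub>b = \<Gamma>\<^sup>a\<^bsub>m b\<^esub> dx\<^sup>m\<close>.\<close>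

definition christoffel ::
    "(real^'n \<Rightarrow> real^'n^'n) \<Rightarrow> 'n \<Rightarrow> 'n \<Rightarrow> 'n \<Rightarrow> real^'n \<Rightarrow> real" where
  "christoffel G a m b y =
     1/2 * (\<Sum>d\<in>UNIV. matrix_inv (G y) $ a $ d *
        (pd (\<lambda>z. G z $ d $ b) m y + pd (\<lambda>z. G z $ d $ m) b y - pd (\<lambda>z. G z $ m $ b) d y))"

text \<open>Mean curvature at parameter \<open>u\<close> of the surface parametrized by \<open>f\<close> in a 3-dimensional
  coordinate domain with Riemannian metric \<open>H\<close>, with respect to the unit normal \<open>n\<close>: the trace
  (with respect to the first fundamental form) of \<open>h(X,Y) = H(\<nabla>\<^sub>X n, Y) = - H(\<nabla>\<^sub>X Y, n)\<close>. Round
  spheres in Euclidean space with their outward normal have positive mean curvature.\<close>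

definition second_fundamental_form ::
    "(real^3 \<Rightarrow> real^3^3) \<Rightarrow> (real^2 \<Rightarrow> real^3) \<Rightarrow> real^2 \<Rightarrow> real^3 \<Rightarrow> real^2^2" where
  "second_fundamental_form H f u n = (\<chi> A B.
     - bil (H (f u))
         (\<chi> i. pd (pd f B) A u $ i +
               (\<Sum>j\<in>UNIV. \<Sum>k\<in>UNIV. christoffel H i j k (f u) * pd f A u $ j * pd f B u $ k))
         n)"

definition mean_curvature ::
    "(real^3 \<Rightarrow> real^3^3) \<Rightarrow> (real^2 \<Rightarrow> real^3) \<Rightarrow> real^2 \<Rightarrow> real^3 \<Rightarrow> real" where
  "mean_curvature H f u n =
     (\<Sum>A\<in>UNIV. \<Sum>B\<in>UNIV. matrix_inv (pullback_metric H f u) $ A $ B *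
        second_fundamental_form H f u n $ A $ B)"


section \<open>Minkowski spacetime\<close>

text \<open>The type \<open>4\<close> consists of \<open>0, 1, 2, 3\<close>; index \<open>0\<close> is the time index. In the types \<open>3\<close> and
  \<open>2\<close> we use the indices \<open>1, 2, 3\<close> (where \<open>3 = 0\<close>) and \<open>1, 2\<close> (where \<open>2 = 0\<close>). Minkowski
  spacetime is \<open>real^4\<close> with coordinates \<open>(T, X, Y, Z)\<close> of index \<open>0, 1, 2, 3\<close>.\<close>

definition minkowski :: "real^4^4" where
  "minkowski = (\<chi> i j. if i = j then (if i = 0 then - 1 else 1) else 0)"

definition spatial :: "real^4 \<Rightarrow> real^3" where
  "spatial y = vector [y$1, y$2, y$3]"

definition slice3 :: "real^3 \<Rightarrow> real^4" where
  "slice3 y = (\<chi> i. if i = 1 then y$1 else if i = 2 then y$2 else if i = 3 then y$3 else 0)"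

definition slice2 :: "real^2 \<Rightarrow> real^4" where
  "slice2 u = (\<chi> i. if i = 2 then u$1 else if i = 3 then u$2 else 0)"


section \<open>Oriented 4-manifolds\<close>

text \<open>A chart is a pair of its domain and its coordinate map. An orientation is given by an atlas
  whose transition maps have positive Jacobian determinants.\<close>

type_synonym 'm chart = "'m set \<times> ('m \<Rightarrow> real^4)"

definition chart_inv :: "'m chart \<Rightarrow> real^4 \<Rightarrow> 'm" where
  "chart_inv c = inv_into (fst c) (snd c)"

definition is_chart :: "('m::topological_space) chart \<Rightarrow> bool" where
  "is_chart c \<longleftrightarrow> open (fst c) \<and> open (snd c ` fst c) \<and>
     homeomorphism (fst c) (snd c ` fst c) (snd c) (chart_inv c)"

definition jac :: "'m chart \<Rightarrow> 'm chart \<Rightarrow> 'm \<Rightarrow> real^4^4" where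
  "jac c d p = matrix (frechet_derivative (snd d \<circ> chart_inv c) (at (snd c p)))"

definition oriented_compatible :: "'m chart \<Rightarrow> 'm chart \<Rightarrow> bool" where
  "oriented_compatible c d \<longleftrightarrow>
     smooth_on (snd c ` (fst c \<inter> fst d)) (snd d \<circ> chart_inv c) \<and>
     smooth_on (snd d ` (fst c \<inter> fst d)) (snd c \<circ> chart_inv d) \<and>
     (\<forall>p\<in>fst c \<inter> fst d. det (jac c d p) > 0)"

definition oriented_atlas :: "('m::topological_space) chart set \<Rightarrow> bool" where
  "oriented_atlas A \<longleftrightarrow> (\<Union>c\<in>A. fst c) = UNIV \<and> (\<forall>c\<in>A. is_chart c) \<and>
     (\<forall>c\<in>A. \<forall>d\<in>A. oriented_compatible c d)"

text \<open>The maximal oriented atlas determined by \<open>A\<close>.\<close>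

definition oriented_charts :: "('m::topological_space) chart set \<Rightarrow> 'm chart set" where
  "oriented_charts A = {c. is_chart c \<and> (\<forall>d\<in>A. oriented_compatible c d)}"

text \<open>Tensors are represented by their components with respect to all oriented charts, subject to
  the transformation laws: \<open>V c p\<close> contains the components at \<open>p\<close>, in the chart \<open>c\<close>, of a vector,
  and \<open>g c p\<close> those of a metric. Values at \<open>p \<notin> fst c\<close> are irrelevant.\<close>

type_synonym 'm vfield = "'m chart \<Rightarrow> 'm \<Rightarrow> real^4"
type_synonym 'm metric = "'m chart \<Rightarrow> 'm \<Rightarrow> real^4^4"

definition metric_coord :: "'m metric \<Rightarrow> 'm chart \<Rightarrow> real^4 \<Rightarrow> real^4^4" where
  "metric_coord g c y = g c (chart_inv c y)"

definition lorentzian_metric :: "('m::topological_space) chart set \<Rightarrow> 'm metric \<Rightarrow> bool" where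
  "lorentzian_metric A g \<longleftrightarrow>
     (\<forall>c\<in>oriented_charts A. smooth_on (snd c ` fst c) (metric_coord g c) \<and>
        (\<forall>p\<in>fst c. transpose (g c p) = g c p \<and>
           (\<exists>P. invertible P \<and> transpose P ** g c p ** P = minkowski))) \<and>
     (\<forall>c\<in>oriented_charts A. \<forall>d\<in>oriented_charts A. \<forall>p\<in>fst c \<inter> fst d.
        g c p = transpose (jac c d p) ** g d p ** jac c d p)"

definition vector_law :: "('m::topological_space) chart set \<Rightarrow> 'm set \<Rightarrow> 'm vfield \<Rightarrow> bool" where
  "vector_law A S V \<longleftrightarrow>
     (\<forall>c\<in>oriented_charts A. \<forall>d\<in>oriented_charts A. \<forall>p\<in>S \<inter> fst c \<inter> fst d.
        V d p = jac c d p *v V c p)"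

definition time_orientation ::
    "('m::topological_space) chart set \<Rightarrow> 'm metric \<Rightarrow> 'm vfield \<Rightarrow> bool" where
  "time_orientation A g \<tau> \<longleftrightarrow> vector_law A UNIV \<tau> \<and>
     (\<forall>c\<in>oriented_charts A. smooth_on (snd c ` fst c) (\<lambda>y. \<tau> c (chart_inv c y)) \<and>
        (\<forall>p\<in>fst c. bil (g c p) (\<tau> c p) (\<tau> c p) < 0))"

definition spacetime ::
    "('m::{t2_space,second_countable_topology}) chart set \<Rightarrow> 'm metric \<Rightarrow> 'm vfield \<Rightarrow> bool" where
  "spacetime A g \<tau> \<longleftrightarrow> oriented_atlas A \<and> lorentzian_metric A g \<and> time_orientation A g \<tau>"

definition future_timelike ::
    "'m metric \<Rightarrow> 'm vfield \<Rightarrow> 'm chart \<Rightarrow> 'm \<Rightarrow> real^4 \<Rightarrow> bool" where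
  "future_timelike g \<tau> c p v \<longleftrightarrow> bil (g c p) v v < 0 \<and> bil (g c p) v (\<tau> c p) < 0"


section \<open>Surfaces\<close>

definition slice_chart :: "('m::topological_space) chart set \<Rightarrow> 'm set \<Rightarrow> 'm chart \<Rightarrow> bool" where
  "slice_chart A S c \<longleftrightarrow> c \<in> oriented_charts A \<and>
     S \<inter> fst c = {p \<in> fst c. snd c p $ 0 = 0 \<and> snd c p $ 1 = 0}"

text \<open>In a slice chart \<open>c\<close>, the surface has the coordinates \<open>(x\<^sup>2, x\<^sup>3)\<close> with parameter domain
  \<open>surf_dom c\<close> and parametrization \<open>chart_inv c \<circ> slice2\<close>.\<close>

definition surf_dom :: "'m chart \<Rightarrow> (real^2) set" where
  "surf_dom c = {u. slice2 u \<in> snd c ` fst c}"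

definition surf_coord :: "'m chart \<Rightarrow> 'm \<Rightarrow> real^2" where
  "surf_coord c p = vector [snd c p $ 2, snd c p $ 3]"

text \<open>An orientation of \<open>S\<close> is given by a set \<open>B\<close> of slice charts covering \<open>S\<close> whose restrictions
  \<open>(x\<^sup>2, x\<^sup>3)\<close> to \<open>S\<close> have transition maps with positive Jacobian determinants.\<close>

definition oriented_closed_surface ::
    "('m::topological_space) chart set \<Rightarrow> 'm set \<Rightarrow> 'm chart set \<Rightarrow> bool" where
  "oriented_closed_surface A S B \<longleftrightarrow> compact S \<and> S \<subseteq> (\<Union>c\<in>B. fst c) \<and>
     (\<forall>c\<in>B. slice_chart A S c) \<and>
     (\<forall>c\<in>B. \<forall>d\<in>B. \<forall>p\<in>S \<inter> fst c \<inter> fst d.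
        jac c d p $ 2 $ 2 * jac c d p $ 3 $ 3 - jac c d p $ 2 $ 3 * jac c d p $ 3 $ 2 > 0)"

definition spacelike_surface ::
    "('m::topological_space) chart set \<Rightarrow> 'm metric \<Rightarrow> 'm set \<Rightarrow> bool" where
  "spacelike_surface A g S \<longleftrightarrow>
     (\<forall>c p v. slice_chart A S c \<and> p \<in> S \<inter> fst c \<and> v $ 0 = 0 \<and> v $ 1 = 0 \<and> v \<noteq> 0
        \<longrightarrow> bil (g c p) v v > 0)"

definition vector_field_along ::
    "('m::topological_space) chart set \<Rightarrow> 'm set \<Rightarrow> 'm vfield \<Rightarrow> bool" where
  "vector_field_along A S V \<longleftrightarrow> vector_law A S V \<and>
     (\<forall>c. slice_chart A S c \<longrightarrow> smooth_on (surf_dom c) (\<lambda>u. V c (chart_inv c (slice2 u))))"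

definition partition_of_unity ::
    "('m::topological_space) chart set \<Rightarrow> 'm set \<Rightarrow> 'm chart set \<Rightarrow> ('m chart \<Rightarrow> 'm \<Rightarrow> real) \<Rightarrow> bool" where
  "partition_of_unity B S C \<rho> \<longleftrightarrow> finite C \<and> C \<subseteq> B \<and>
     (\<forall>c\<in>C. continuous_on S (\<rho> c) \<and> (\<forall>p\<in>S. \<rho> c p \<ge> 0) \<and>
        closure {p \<in> S. \<rho> c p \<noteq> 0} \<subseteq> fst c) \<and>
     (\<forall>p\<in>S. (\<Sum>c\<in>C. \<rho> c p) = 1)"

text \<open>The integral over \<open>S\<close>, with the orientation \<open>B\<close>, of the 2-form with
  \<open>\<alpha> = \<alpha>(\<partial>\<^sub>2, \<partial>\<^sub>3) dx\<^sup>2 \<and> dx\<^sup>3\<close> on \<open>S\<close>, where \<open>\<Phi> c p\<close> is \<open>\<alpha>(\<partial>\<^sub>2, \<partial>\<^sub>3)\<close> at \<open>p\<close> in the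
  chart \<open>c\<close>. As usual, it does not depend on the partition of unity.\<close>

definition surface_integral ::
    "('m::topological_space) chart set \<Rightarrow> 'm set \<Rightarrow> ('m chart \<Rightarrow> 'm \<Rightarrow> real) \<Rightarrow> real" where
  "surface_integral B S \<Phi> =
     (let (C, \<rho>) = (SOME (C, \<rho>). partition_of_unity B S C \<rho>) in
        \<Sum>c\<in>C. integral (surf_dom c)
          (\<lambda>u. \<rho> c (chart_inv c (slice2 u)) * \<Phi> c (chart_inv c (slice2 u))))"

text \<open>The component of the area form of \<open>S\<close>.\<close>

definition area_density :: "'m metric \<Rightarrow> 'm chart \<Rightarrow> 'm \<Rightarrow> real" where
  "area_density g c p =
     sqrt (det (pullback_metric (metric_coord g c) slice2 (surf_coord c p)))"


section \<open>Enclosed spacelike domains\<close>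

text \<open>The domain \<open>\<Omega>\<close> is a compact embedded hypersurface with boundary \<open>S\<close> (with \<open>S \<subseteq> \<Omega>\<close>),
  described by charts adapted to it at boundary points and at interior points.\<close>

definition boundary_chart ::
    "('m::topological_space) chart set \<Rightarrow> 'm set \<Rightarrow> 'm set \<Rightarrow> 'm chart \<Rightarrow> bool" where
  "boundary_chart A S \<Omega> d \<longleftrightarrow> slice_chart A S d \<and>
     \<Omega> \<inter> fst d = {p \<in> fst d. snd d p $ 0 = 0 \<and> snd d p $ 1 \<le> 0}"

definition interior_chart ::
    "('m::topological_space) chart set \<Rightarrow> 'm set \<Rightarrow> 'm set \<Rightarrow> 'm chart \<Rightarrow> bool" where
  "interior_chart A S \<Omega> d \<longleftrightarrow> d \<in> oriented_charts A \<and> S \<inter> fst d = {} \<and>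
     \<Omega> \<inter> fst d = {p \<in> fst d. snd d p $ 0 = 0}"

definition encloses ::
    "('m::topological_space) chart set \<Rightarrow> 'm set \<Rightarrow> 'm set \<Rightarrow> bool" where
  "encloses A S \<Omega> \<longleftrightarrow> compact \<Omega> \<and> connected \<Omega> \<and> S \<subseteq> \<Omega> \<and>
     (\<forall>p\<in>S. \<exists>d. boundary_chart A S \<Omega> d \<and> p \<in> fst d) \<and>
     (\<forall>p\<in>\<Omega> - S. \<exists>d. interior_chart A S \<Omega> d \<and> p \<in> fst d)"

definition spacelike_domain ::
    "('m::topological_space) chart set \<Rightarrow> 'm metric \<Rightarrow> 'm set \<Rightarrow> 'm set \<Rightarrow> bool" where
  "spacelike_domain A g S \<Omega> \<longleftrightarrow>
     (\<forall>d p v. (boundary_chart A S \<Omega> d \<or> interior_chart A S \<Omega> d) \<and> p \<in> \<Omega> \<inter> fst d \<and>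
        v $ 0 = 0 \<and> v \<noteq> 0 \<longrightarrow> bil (g d p) v v > 0)"

definition orthogonal_to_domain ::
    "('m::topological_space) chart set \<Rightarrow> 'm metric \<Rightarrow> 'm set \<Rightarrow> 'm set \<Rightarrow> 'm vfield \<Rightarrow> bool" where
  "orthogonal_to_domain A g S \<Omega> N \<longleftrightarrow>
     (\<forall>d p v. boundary_chart A S \<Omega> d \<and> p \<in> S \<inter> fst d \<and> v $ 0 = 0
        \<longrightarrow> bil (g d p) (N d p) v = 0)"

text \<open>The outward unit normal and the mean curvature below do not depend on the chosen chart.\<close>

definition boundary_chart_at ::
    "('m::topological_space) chart set \<Rightarrow> 'm set \<Rightarrow> 'm set \<Rightarrow> 'm \<Rightarrow> 'm chart" where
  "boundary_chart_at A S \<Omega> p = (SOME d. boundary_chart A S \<Omega> d \<and> p \<in> fst d)"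

definition domain_metric :: "'m metric \<Rightarrow> 'm chart \<Rightarrow> real^3 \<Rightarrow> real^3^3" where
  "domain_metric g d = pullback_metric (metric_coord g d) slice3"

definition outward_normal_in ::
    "'m metric \<Rightarrow> 'm chart \<Rightarrow> 'm \<Rightarrow> real^3" where
  "outward_normal_in g d p = (THE n. let H = domain_metric g d (spatial (snd d p)) in
     bil H n n = 1 \<and> bil H n (axis 2 1) = 0 \<and> bil H n (axis 3 1) = 0 \<and> n $ 1 > 0)"

definition outward_normal ::
    "('m::topological_space) chart set \<Rightarrow> 'm metric \<Rightarrow> 'm set \<Rightarrow> 'm set \<Rightarrow> 'm vfield" where
  "outward_normal A g S \<Omega> c p =
     (let d = boundary_chart_at A S \<Omega> p in jac d c p *v slice3 (outward_normal_in g d p))"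

text \<open>\<open>S\<close> has the equation \<open>x\<^sup>1 = 0\<close> in the coordinates \<open>(x\<^sup>1, x\<^sup>2, x\<^sup>3)\<close> of \<open>\<Omega>\<close>.\<close>

definition mean_curvature_in_domain ::
    "('m::topological_space) chart set \<Rightarrow> 'm metric \<Rightarrow> 'm set \<Rightarrow> 'm set \<Rightarrow> 'm \<Rightarrow> real" where
  "mean_curvature_in_domain A g S \<Omega> p =
     (let d = boundary_chart_at A S \<Omega> p in
        mean_curvature (domain_metric g d) (\<lambda>u. vector [0, u$1, u$2]) (surf_coord d p)
          (outward_normal_in g d p))"

definition orientation_matches ::
    "('m::topological_space) chart set \<Rightarrow> 'm metric \<Rightarrow> 'm set \<Rightarrow> 'm chart set \<Rightarrow> 'm set \<Rightarrow> 'm vfield \<Rightarrow> bool"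
  where
  "orientation_matches A g S B \<Omega> N \<longleftrightarrow>
     (\<forall>c\<in>B. \<forall>p\<in>S \<inter> fst c.
        det ((\<chi> i. if i = 0 then N c p else if i = 1 then outward_normal A g S \<Omega> c p
                   else axis i 1) :: real^4^4) > 0)"


section \<open>Reference embeddings into Minkowski spacetime\<close>

definition pushforward :: "('m \<Rightarrow> real^4) \<Rightarrow> 'm chart \<Rightarrow> 'm \<Rightarrow> real^4 \<Rightarrow> real^4" where
  "pushforward \<phi> c p v = frechet_derivative (\<phi> \<circ> chart_inv c) (at (snd c p)) v"

definition pullback_minkowski :: "('m \<Rightarrow> real^4) \<Rightarrow> 'm metric" where
  "pullback_minkowski \<phi> c p = pullback_metric (\<lambda>_. minkowski) (\<phi> \<circ> chart_inv c) (snd c p)"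

text \<open>Time orientation is only compared on \<open>S\<close>: elsewhere the metrics \<open>g\<close> and \<open>\<phi>\<^sup>*\<eta>\<close> of a
  reference need not be related.\<close>

definition reference ::
    "('m::topological_space) chart set \<Rightarrow> 'm metric \<Rightarrow> 'm vfield \<Rightarrow> 'm set \<Rightarrow> 'm set \<Rightarrow> ('m \<Rightarrow> real^4) \<Rightarrow> bool"
  where
  "reference A g \<tau> S U \<phi> \<longleftrightarrow> open U \<and> S \<subseteq> U \<and>
     homeomorphism U (\<phi> ` U) \<phi> (inv_into U \<phi>) \<and>
     (\<forall>c\<in>oriented_charts A. smooth_on (snd c ` (U \<inter> fst c)) (\<phi> \<circ> chart_inv c) \<and>
        (\<forall>p\<in>U \<inter> fst c. det (matrix (pushforward \<phi> c p)) > 0) \<and>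
        (\<forall>p\<in>S \<inter> fst c. \<forall>v. future_timelike g \<tau> c p v \<and>
           bil minkowski (pushforward \<phi> c p v) (pushforward \<phi> c p v) < 0
             \<longrightarrow> pushforward \<phi> c p v $ 0 > 0))"

definition isometric_matching_reference ::
    "('m::topological_space) chart set \<Rightarrow> 'm metric \<Rightarrow> 'm vfield \<Rightarrow> 'm set \<Rightarrow> 'm set \<Rightarrow> ('m \<Rightarrow> real^4) \<Rightarrow> bool"
  where
  "isometric_matching_reference A g \<tau> S U \<phi> \<longleftrightarrow> reference A g \<tau> S U \<phi> \<and>
     (\<forall>c\<in>oriented_charts A. \<forall>p\<in>S \<inter> fst c. pullback_minkowski \<phi> c p = g c p)"


section \<open>Chen-Nester-Tung quasi-local energy\<close>

text \<open>The totally antisymmetric symbol with \<open>\<epsilon>\<^bsub>0123\<^esub> = 1\<close>.\<close>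

definition eps :: "4 \<Rightarrow> 4 \<Rightarrow> 4 \<Rightarrow> 4 \<Rightarrow> real" where
  "eps a b m n = det ((\<chi> i. if i = 0 then axis a 1 else if i = 1 then axis b 1
                             else if i = 2 then axis m 1 else axis n 1) :: real^4^4)"

definition eta_form :: "real^4^4 \<Rightarrow> 4 \<Rightarrow> 4 \<Rightarrow> real^4 \<Rightarrow> real^4 \<Rightarrow> real" where
  "eta_form G a b X Y =
     1/2 * sqrt (- det G) * (\<Sum>\<beta>\<in>UNIV. \<Sum>m\<in>UNIV. \<Sum>n\<in>UNIV.
        matrix_inv G $ b $ \<beta> * eps a \<beta> m n * (X $ m * Y $ n - X $ n * Y $ m))"

definition connection_form :: "'m metric \<Rightarrow> 'm chart \<Rightarrow> 'm \<Rightarrow> 4 \<Rightarrow> 4 \<Rightarrow> real^4 \<Rightarrow> real" where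
  "connection_form g c p a b X =
     (\<Sum>m\<in>UNIV. christoffel (metric_coord g c) a m b (snd c p) * X $ m)"

definition wedge :: "(real^4 \<Rightarrow> real) \<Rightarrow> (real^4 \<Rightarrow> real) \<Rightarrow> real^4 \<Rightarrow> real^4 \<Rightarrow> real" where
  "wedge \<alpha> \<beta> X Y = \<alpha> X * \<beta> Y - \<alpha> Y * \<beta> X"

text \<open>The coordinate frame of \<open>c\<close> serves as the common frame of the two connections.\<close>

definition cnt_form ::
    "'m metric \<Rightarrow> 'm vfield \<Rightarrow> ('m \<Rightarrow> real^4) \<Rightarrow> 'm chart \<Rightarrow> 'm \<Rightarrow> real^4 \<Rightarrow> real^4 \<Rightarrow> real" where
  "cnt_form g N \<phi> c p X Y = (\<Sum>a\<in>UNIV. \<Sum>b\<in>UNIV.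
     wedge (\<lambda>V. connection_form g c p a b V - connection_form (pullback_minkowski \<phi>) c p a b V)
           (\<lambda>V. eta_form (g c p) a b (N c p) V) X Y)"

definition cnt_energy ::
    "'m metric \<Rightarrow> ('m::topological_space) chart set \<Rightarrow> 'm set \<Rightarrow> 'm vfield \<Rightarrow> ('m \<Rightarrow> real^4) \<Rightarrow> real" where
  "cnt_energy g B S N \<phi> =
     1 / (16 * pi) * surface_integral B S (\<lambda>c p. cnt_form g N \<phi> c p (axis 2 1) (axis 3 1))"


section \<open>Brown-York mass\<close>

text \<open>The vector \<open>n\<close> at the point \<open>q\<close> of the closed surface \<open>\<Sigma>\<close> in Euclidean space points from
  the region enclosed by \<open>\<Sigma>\<close> to the unbounded region.\<close>

definition points_outward :: "(real^3) set \<Rightarrow> real^3 \<Rightarrow> real^3 \<Rightarrow> bool" where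
  "points_outward \<Sigma> q n \<longleftrightarrow>
     (\<exists>\<epsilon>>0. \<forall>t. 0 < t \<and> t < \<epsilon> \<longrightarrow> q + t *\<^sub>R n \<in> outside \<Sigma> \<and> q - t *\<^sub>R n \<in> inside \<Sigma>)"

definition euclidean_outward_normal ::
    "(real^3) set \<Rightarrow> (real^2 \<Rightarrow> real^3) \<Rightarrow> real^2 \<Rightarrow> real^3" where
  "euclidean_outward_normal \<Sigma> f u =
     (THE n. norm n = 1 \<and> (\<forall>A. n \<bullet> pd f A u = 0) \<and> points_outward \<Sigma> (f u) n)"

text \<open>Mean curvature of \<open>\<psi> ` S\<close>, for an embedding \<open>\<psi>\<close> of \<open>S\<close> into Euclidean space.\<close>

definition euclidean_mean_curvature ::
    "'m set \<Rightarrow> ('m \<Rightarrow> real^3) \<Rightarrow> 'm chart \<Rightarrow> 'm \<Rightarrow> real" where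
  "euclidean_mean_curvature S \<psi> c p =
     (let f = \<psi> \<circ> chart_inv c \<circ> slice2; u = surf_coord c p in
        mean_curvature (\<lambda>_. mat 1) f u (euclidean_outward_normal (\<psi> ` S) f u))"

text \<open>The isometric embedding \<open>\<psi>\<close> is an argument, as it is in general not unique up to rigid
  motions.\<close>

definition brown_york_mass ::
    "('m::topological_space) chart set \<Rightarrow> 'm metric \<Rightarrow> 'm chart set \<Rightarrow> 'm set \<Rightarrow> 'm set \<Rightarrow>
     ('m \<Rightarrow> real^3) \<Rightarrow> real" where
  "brown_york_mass A g B S \<Omega> \<psi> =
     1 / (8 * pi) * surface_integral B S
       (\<lambda>c p. (euclidean_mean_curvature S \<psi> c p - mean_curvature_in_domain A g S \<Omega> p)
              * area_density g c p)"

end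

theory Submission
  imports Defs
begin

text \<open>Both energies are integrals over \<open>S\<close>, so it suffices to compare the integrands. Let
  \<open>E = g - \<phi>\<^sup>*\<eta>\<close>. It vanishes along \<open>S\<close>; hence its first derivatives along \<open>S\<close> behave as a tensor
  \<open>D(X; v, w) = (\<partial>\<^sub>X E)(v, w)\<close>, which is zero for \<open>X\<close> tangent to \<open>S\<close> and determines the difference of
  the two connections. In a frame consisting of \<open>N\<close>, the outward normal \<open>\<nu>\<close> and two tangent vectors
  of \<open>S\<close>, the only components of \<open>D\<close> that survive in the Chen-Nester-Tung form give
  \<open>- \<sigma>\<^sup>A\<^sup>B D(\<nu>; e\<^sub>A, e\<^sub>B) dV\<close>. On the other hand, \<open>\<phi>\<^sub>*\<nu>\<close> is the outward normal of \<open>\<phi>(S)\<close> in Euclidean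
  space, and the difference of the second fundamental forms of \<open>S\<close> is \<open>- D(\<nu>; e\<^sub>A, e\<^sub>B) / 2\<close>.\<close>

section \<open>Linear algebra\<close>

text \<open>The two integrands live in different charts: the Chen-Nester-Tung form is evaluated in
  an orienting chart \<open>c\<close>, whereas the normal and the mean curvature of S in \<Omega>
  are defined through a chosen boundary chart \<open>d\<close>. Christoffel symbols are not
  tensorial, so neither side can simply be rewritten in the other chart. What does transform well is
  the derivative of E (because E = 0 on S) and the Hessian of a function at a critical point; the
  comparison of second-order data in \<open>c\<close> and \<open>d\<close> rests on these two facts.
  In \<open>d\<close> the second fundamental form of S in \<Omega> is a combination of first
  derivatives of g; with the flat metric in place of g it becomes the Hessian of a height function
  of \<phi>(S). Unit length and orthogonality leave the sign of the Euclidean normal open, and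
  orientation does not settle it: the antipodal map of a round sphere extends near the sphere to an
  orientation-preserving map that exchanges its two sides. The theorem therefore assumes that \<phi>
  carries the outward normal of S to a vector pointing outward from \<phi>(S).\<close>

lemma sum_UNIV_4: "sum f (UNIV::4 set) = f 0 + f 1 + f 2 + f 3"
proof -
  \<comment> \<open>The numeral 4 denotes 0 in this type, so the last index becomes the time
    index.\<close>
  have "f 4 = f 0" by (rule arg_cong[where f = f]) simp
  then show ?thesis unfolding sum_4 by (simp add: ac_simps)
qed

lemma all_4: "(\<forall>i::4. P i) \<longleftrightarrow> P 0 \<and> P 1 \<and> P 2 \<and> P 3"
proof -
  have "P 4 = P 0" by (rule arg_cong[where f = P]) simp
  then show ?thesis unfolding forall_4 by auto
qed

lemma det_4:
  "det (A::'a::comm_ring_1^4^4) =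
    A$0$0 * (A$1$1 * (A$2$2 * A$3$3 - A$2$3 * A$3$2) - A$1$2 * (A$2$1 * A$3$3 - A$2$3 * A$3$1)
      + A$1$3 * (A$2$1 * A$3$2 - A$2$2 * A$3$1)) -
    A$0$1 * (A$1$0 * (A$2$2 * A$3$3 - A$2$3 * A$3$2) - A$1$2 * (A$2$0 * A$3$3 - A$2$3 * A$3$0)
      + A$1$3 * (A$2$0 * A$3$2 - A$2$2 * A$3$0)) +
    A$0$2 * (A$1$0 * (A$2$1 * A$3$3 - A$2$3 * A$3$1) - A$1$1 * (A$2$0 * A$3$3 - A$2$3 * A$3$0)
      + A$1$3 * (A$2$0 * A$3$1 - A$2$1 * A$3$0)) -
    A$0$3 * (A$1$0 * (A$2$1 * A$3$2 - A$2$2 * A$3$1) - A$1$1 * (A$2$0 * A$3$2 - A$2$2 * A$3$0)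
      + A$1$2 * (A$2$0 * A$3$1 - A$2$1 * A$3$0))"
proof -
  have U: "(UNIV::4 set) = {0,1,2,3}" 
    using all_4[of "\<lambda>i. i \<in> {0,1,2,3}"] by auto
  have f1: "finite {1::4, 2, 3}" "0 \<notin> {1::4, 2, 3}"
    by auto
  have f2: "finite {2::4, 3}" "1 \<notin> {2::4, 3}"
    by auto
  have f3: "finite {3::4}" "2 \<notin> {3::4}"
    by auto
  show ?thesis
    unfolding det_def U
    unfolding sum_over_permutations_insert[OF f1]
    unfolding sum_over_permutations_insert[OF f2]
    unfolding sum_over_permutations_insert[OF f3]
    unfolding permutes_sing
    by (simp add: sign_swap_id permutation_swap_id permutation_compose sign_compose sign_id swap_id_eq algebra_simps)
qed

section \<open>Inverse metrics and traces under a change of frame\<close>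

lemma matrix_inv_eq:
  fixes A B :: "real^'n^'n"
  assumes "A ** B = mat 1"
  shows "matrix_inv A = B"
proof -
  have "B ** A = mat 1" using assms by (simp add: matrix_left_right_inverse)
  then have "A ** matrix_inv A = mat 1"
    using assms matrix_inv_def[of A] by (metis (mono_tags, lifting) someI_ex)
  then show ?thesis
    by (metis \<open>B ** A = mat 1\<close> matrix_mul_assoc matrix_mul_lid matrix_mul_rid)
qed

lemma matrix_inv_cancel:
  fixes A :: "real^'n^'n"
  assumes "det A \<noteq> 0"
  shows "A ** matrix_inv A = mat 1" "matrix_inv A ** A = mat 1"
proof -
  obtain B where "A ** B = mat 1" 
    using assms invertible_det_nz[of A] unfolding invertible_def by blast
  then show "A ** matrix_inv A = mat 1" "matrix_inv A ** A = mat 1"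
    using matrix_inv_eq matrix_left_right_inverse by metis+
qed

text \<open>The columns of \<open>P\<close> are a frame for the metric \<open>M\<close>, and
  \<open>Q\<close> is its Gram matrix. Writing the inverse metric through the frame lets
  contractions be computed where the Gram matrix is simple.\<close>

lemma matrix_inv_congruence:
  fixes M Q P :: "real^'n^'n"
  assumes "transpose P ** M ** P = Q" "Q ** R = mat 1"
  shows "matrix_inv M = P ** R ** transpose P"
proof (rule matrix_inv_eq)
  have "det Q \<noteq> 0" using assms(2) by (metis det_I det_mul mult_zero_left zero_neq_one)
  then have "det P \<noteq> 0" using assms(1) by (auto simp: det_mul)
  then have P: "P ** matrix_inv P = mat 1" "matrix_inv P ** P = mat 1"
    using matrix_inv_cancel by auto
  let ?T = "transpose P" let ?Ti = "transpose (matrix_inv P)"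
  have T: "?T ** ?Ti = mat 1" "?Ti ** ?T = mat 1"
    using P by (simp_all add: matrix_transpose_mul[symmetric])
  have "M ** (P ** R ** ?T) = (?Ti ** ?T) ** M ** P ** R ** ?T"
    by (simp add: T matrix_mul_assoc)
  also have "\<dots> = ?Ti ** (?T ** M ** P ** R) ** ?T"
    by (simp add: matrix_mul_assoc)
  also have "\<dots> = mat 1" using assms T by simp
  finally show "M ** (P ** R ** ?T) = mat 1" .
qed

text \<open>Cyclicity of the trace cancels the Jacobian \<open>K\<close>. This is the coordinate
  independence of the mean curvature, by which traces taken in two charts are compared.\<close>

lemma metric_trace_congruence:
  fixes \<sigma> h \<sigma>' h' K :: "real^'n^'n"
  assumes "\<sigma>' = transpose K ** \<sigma> ** K" "h' = transpose K ** h ** K" "det \<sigma>' \<noteq> 0"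
  shows "(\<Sum>a\<in>UNIV. \<Sum>b\<in>UNIV. matrix_inv \<sigma>' $ a $ b * h' $ a $ b) =
    (\<Sum>a\<in>UNIV. \<Sum>b\<in>UNIV. matrix_inv \<sigma> $ a $ b * h $ a $ b)"
proof -
  have tr: "(\<Sum>a\<in>UNIV. \<Sum>b\<in>UNIV. X $ a $ b * Y $ a $ b) = trace (X ** transpose Y)" for X Y :: "real^'n^'n"
    by (simp add: trace_def matrix_matrix_mult_def transpose_def)
  have inv: "matrix_inv \<sigma> = K ** matrix_inv \<sigma>' ** transpose K"
    by (rule matrix_inv_congruence) (use assms matrix_inv_cancel in auto)
  have "trace (matrix_inv \<sigma>' ** transpose h') = trace (matrix_inv \<sigma>' ** transpose K ** (transpose h ** K))"
    by (simp add: assms(2) matrix_transpose_mul matrix_mul_assoc)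
  also have "\<dots> = trace (transpose h ** K ** (matrix_inv \<sigma>' ** transpose K))"
    by (rule trace_mul_sym)
  also have "\<dots> = trace (transpose h ** matrix_inv \<sigma>)"
    by (simp add: inv matrix_mul_assoc)
  also have "\<dots> = trace (matrix_inv \<sigma> ** transpose h)" by (rule trace_mul_sym)
  finally show ?thesis by (simp add: tr)
qed

lemma bilinear_expansion:
  fixes B :: "real^'n \<Rightarrow> real^'k \<Rightarrow> real"
  assumes "bilinear B"
  shows "B v w = (\<Sum>i\<in>UNIV. \<Sum>j\<in>UNIV. v $ i * w $ j * B (axis i 1) (axis j 1))"
proof -
  have "B v w = B (\<Sum>i\<in>UNIV. v $ i *\<^sub>R axis i 1) (\<Sum>j\<in>UNIV. w $ j *\<^sub>R axis j 1)"
    using basis_expansion[of v] basis_expansion[of w] by (simp add: scalar_mult_eq_scaleR)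
  also have "\<dots> = (\<Sum>i\<in>UNIV. \<Sum>j\<in>UNIV. v $ i * w $ j * B (axis i 1) (axis j 1))"
    by (simp add: bilinear_sum[OF assms] sum.cartesian_product bilinear_lmul[OF assms]
      bilinear_rmul[OF assms] split_beta mult_ac)
  finally show ?thesis .
qed

text \<open>A contraction with the inverse metric over coordinate indices becomes one over the frame
  formed by the columns of \<open>P\<close>; the proof only reorders finite sums.\<close>

lemma metric_trace_change_basis:
  fixes P R :: "real^'n^'n"
  assumes "bilinear B" "M = P ** R ** transpose P"
  shows "(\<Sum>a\<in>UNIV. \<Sum>b\<in>UNIV. M $ a $ b * B (axis a 1) (axis b 1)) =
    (\<Sum>i\<in>UNIV. \<Sum>j\<in>UNIV. R $ i $ j * B (column i P) (column j P))"
proof -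
  have "(\<Sum>i\<in>UNIV. \<Sum>j\<in>UNIV. R $ i $ j * B (column i P) (column j P)) =
    (\<Sum>i\<in>UNIV. \<Sum>j\<in>UNIV. \<Sum>a\<in>UNIV. \<Sum>b\<in>UNIV. R $ i $ j * (P $ a $ i * P $ b $ j * B (axis a 1) (axis b 1)))"
    by (subst bilinear_expansion[OF assms(1)]) (simp add: sum_distrib_left column_def)
  also have "\<dots> = (\<Sum>i\<in>UNIV. \<Sum>a\<in>UNIV. \<Sum>j\<in>UNIV. \<Sum>b\<in>UNIV. R $ i $ j * (P $ a $ i * P $ b $ j * B (axis a 1) (axis b 1)))"
    by (rule sum.cong[OF refl], rule sum.swap)
  also have "\<dots> = (\<Sum>a\<in>UNIV. \<Sum>i\<in>UNIV. \<Sum>b\<in>UNIV. \<Sum>j\<in>UNIV. R $ i $ j * (P $ a $ i * P $ b $ j * B (axis a 1) (axis b 1)))"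
    by (subst sum.swap, rule sum.cong[OF refl], rule sum.cong[OF refl], rule sum.swap)
  also have "\<dots> = (\<Sum>a\<in>UNIV. \<Sum>b\<in>UNIV. \<Sum>i\<in>UNIV. \<Sum>j\<in>UNIV. R $ i $ j * (P $ a $ i * P $ b $ j * B (axis a 1) (axis b 1)))"
    by (rule sum.cong[OF refl], rule sum.swap)
  also have "\<dots> = (\<Sum>a\<in>UNIV. \<Sum>b\<in>UNIV. \<Sum>j\<in>UNIV. \<Sum>i\<in>UNIV. R $ i $ j * (P $ a $ i * P $ b $ j * B (axis a 1) (axis b 1)))"
    by (rule sum.cong[OF refl], rule sum.cong[OF refl], rule sum.swap)
  also have "\<dots> = (\<Sum>a\<in>UNIV. \<Sum>b\<in>UNIV. M $ a $ b * B (axis a 1) (axis b 1))"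
    by (simp add: assms(2) matrix_matrix_mult_def transpose_def sum_distrib_left sum_distrib_right mult_ac)
  finally show ?thesis by simp
qed

section \<open>The four-dimensional volume form\<close>

definition vol :: "real^4 \<Rightarrow> real^4 \<Rightarrow> real^4 \<Rightarrow> real^4 \<Rightarrow> real" where
  "vol v w x y = det ((\<chi> i. if i = 0 then v else if i = 1 then w else if i = 2 then x else y) :: real^4^4)"

lemmas vol_expand = vol_def det_4

lemma bilinear_vol:
  shows "bilinear (\<lambda>v w. vol v w x y)" "bilinear (\<lambda>x y. vol v w x y)"
  by (auto simp: bilinear_def vol_expand algebra_simps intro!: linearI)

lemma vol_swap: "vol v w y x = - vol v w x y"
  by (simp add: vol_expand algebra_simps)

lemma vol_same: "vol v v x y = 0" "vol v w v y = 0" "vol v w x v = 0" "vol v w w y = 0" "vol v w x w = 0" "vol v w x x = 0"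
  by (simp_all add: vol_expand algebra_simps)

text \<open>Antisymmetrising in \<open>X\<close> and \<open>Y\<close> counts every term twice, which
  cancels the factor 1/2 and leaves the metric volume form with its second index raised.\<close>

lemma eta_form_eq:
  "eta_form G a b X Y = sqrt (- det G) * (\<Sum>\<beta>\<in>UNIV. matrix_inv G $ b $ \<beta> * vol (axis a 1) (axis \<beta> 1) X Y)"
proof -
  have *: "(\<Sum>m\<in>UNIV. \<Sum>n\<in>UNIV. matrix_inv G $ b $ \<beta> * eps a \<beta> m n * (X $ m * Y $ n - X $ n * Y $ m)) =
    2 * (matrix_inv G $ b $ \<beta> * vol (axis a 1) (axis \<beta> 1) X Y)" for \<beta>
  proof -
    have eps: "eps a \<beta> m n = vol (axis a 1) (axis \<beta> 1) (axis m 1) (axis n 1)" for m n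
      by (simp add: eps_def vol_def)
    have "(\<Sum>m\<in>UNIV. \<Sum>n\<in>UNIV. matrix_inv G $ b $ \<beta> * eps a \<beta> m n * (X $ m * Y $ n - X $ n * Y $ m))
      = matrix_inv G $ b $ \<beta> * ((\<Sum>m\<in>UNIV. \<Sum>n\<in>UNIV. X $ m * Y $ n * eps a \<beta> m n)
        - (\<Sum>m\<in>UNIV. \<Sum>n\<in>UNIV. Y $ m * X $ n * eps a \<beta> m n))"
      by (simp add: sum_distrib_left sum_subtractf[symmetric] algebra_simps)
    also have "\<dots> = matrix_inv G $ b $ \<beta> * (vol (axis a 1) (axis \<beta> 1) X Y - vol (axis a 1) (axis \<beta> 1) Y X)"
      by (simp add: eps bilinear_expansion[OF bilinear_vol(2), symmetric])
    also have "\<dots> = 2 * (matrix_inv G $ b $ \<beta> * vol (axis a 1) (axis \<beta> 1) X Y)"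
      by (simp add: vol_swap[of _ _ Y X])
    finally show ?thesis .
  qed
  show ?thesis unfolding eta_form_def * by (simp add: sum_distrib_left)
qed


text \<open>A connection difference contracted with \<eta> contains two inverse metrics, one pairing
  \<open>a\<close> with \<open>d\<close>, the other pairing \<open>b\<close> with
  \<open>\<beta>\<close>. With one pair frozen the summand is bilinear in the other, so the frame
  change of a single contraction can be applied twice.\<close>

lemma double_contraction:
  fixes P R :: "real^'n^'n"
  assumes "bilinear \<tau>" "bilinear \<nu>" "M = P ** R ** transpose P"
  shows "(\<Sum>a\<in>UNIV. \<Sum>b\<in>UNIV. (\<Sum>d\<in>UNIV. M $ a $ d * \<tau> (axis d 1) (axis b 1)) *
      (\<Sum>\<beta>\<in>UNIV. M $ b $ \<beta> * \<nu> (axis a 1) (axis \<beta> 1))) =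
    (\<Sum>i\<in>UNIV. \<Sum>j\<in>UNIV. \<Sum>k\<in>UNIV. \<Sum>l\<in>UNIV. R $ i $ j * R $ k $ l *
      (\<tau> (column j P) (column k P) * \<nu> (column i P) (column l P)))"
proof -
  have B1: "bilinear (\<lambda>x y. \<tau> y w * \<nu> x z)" and B2: "bilinear (\<lambda>x y. \<tau> w x * \<nu> z y)" for w z
    using assms(1,2) by (auto simp: bilinear_def linear_iff algebra_simps)
  have "(\<Sum>a\<in>UNIV. \<Sum>b\<in>UNIV. (\<Sum>d\<in>UNIV. M $ a $ d * \<tau> (axis d 1) (axis b 1)) *
      (\<Sum>\<beta>\<in>UNIV. M $ b $ \<beta> * \<nu> (axis a 1) (axis \<beta> 1))) =
    (\<Sum>a\<in>UNIV. \<Sum>b\<in>UNIV. \<Sum>d\<in>UNIV. \<Sum>\<beta>\<in>UNIV. M $ b $ \<beta> * (M $ a $ d * (\<tau> (axis d 1) (axis b 1) *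
      \<nu> (axis a 1) (axis \<beta> 1))))"
    by (simp add: sum_product mult_ac)
  also have "\<dots> = (\<Sum>b\<in>UNIV. \<Sum>a\<in>UNIV. \<Sum>\<beta>\<in>UNIV. \<Sum>d\<in>UNIV. M $ b $ \<beta> * (M $ a $ d * (\<tau> (axis d 1) (axis b 1) *
      \<nu> (axis a 1) (axis \<beta> 1))))"
    by (subst sum.swap, rule sum.cong[OF refl], rule sum.cong[OF refl], rule sum.swap)
  also have "\<dots> = (\<Sum>b\<in>UNIV. \<Sum>\<beta>\<in>UNIV. \<Sum>a\<in>UNIV. \<Sum>d\<in>UNIV. M $ b $ \<beta> * (M $ a $ d * (\<tau> (axis d 1) (axis b 1) *
      \<nu> (axis a 1) (axis \<beta> 1))))"
    by (rule sum.cong[OF refl], rule sum.swap)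
  also have "\<dots> = (\<Sum>b\<in>UNIV. \<Sum>\<beta>\<in>UNIV. M $ b $ \<beta> * (\<Sum>i\<in>UNIV. \<Sum>j\<in>UNIV. R $ i $ j *
      (\<tau> (column j P) (axis b 1) * \<nu> (column i P) (axis \<beta> 1))))"
    by (simp only: sum_distrib_left[symmetric] metric_trace_change_basis[OF B1 assms(3)])
  also have "\<dots> = (\<Sum>b\<in>UNIV. \<Sum>i\<in>UNIV. \<Sum>\<beta>\<in>UNIV. \<Sum>j\<in>UNIV. R $ i $ j * (M $ b $ \<beta> *
      (\<tau> (column j P) (axis b 1) * \<nu> (column i P) (axis \<beta> 1))))"
    by (simp only: sum_distrib_left mult.left_commute, rule sum.cong[OF refl], rule sum.swap)
  also have "\<dots> = (\<Sum>i\<in>UNIV. \<Sum>b\<in>UNIV. \<Sum>j\<in>UNIV. \<Sum>\<beta>\<in>UNIV. R $ i $ j * (M $ b $ \<beta> *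
      (\<tau> (column j P) (axis b 1) * \<nu> (column i P) (axis \<beta> 1))))"
    by (subst sum.swap, rule sum.cong[OF refl], rule sum.cong[OF refl], rule sum.swap)
  also have "\<dots> = (\<Sum>i\<in>UNIV. \<Sum>j\<in>UNIV. \<Sum>b\<in>UNIV. \<Sum>\<beta>\<in>UNIV. R $ i $ j * (M $ b $ \<beta> *
      (\<tau> (column j P) (axis b 1) * \<nu> (column i P) (axis \<beta> 1))))"
    by (rule sum.cong[OF refl], rule sum.swap)
  also have "\<dots> = (\<Sum>i\<in>UNIV. \<Sum>j\<in>UNIV. R $ i $ j * (\<Sum>k\<in>UNIV. \<Sum>l\<in>UNIV. R $ k $ l *
      (\<tau> (column j P) (column k P) * \<nu> (column i P) (column l P))))"
    by (simp only: sum_distrib_left[symmetric] metric_trace_change_basis[OF B2 assms(3)])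
  finally show ?thesis by (simp add: sum_distrib_left mult.assoc)
qed

text \<open>The Gram matrix of a frame consisting of a unit timelike vector, a unit spacelike vector
  orthogonal to it, and two vectors with Gram matrix \<open>\<sigma>\<close> orthogonal to both.\<close>

definition adapted :: "real^2^2 \<Rightarrow> real^4^4" where
  "adapted \<sigma> = (\<chi> i j. if i = 0 \<and> j = 0 then - 1 else if i = 1 \<and> j = 1 then 1
     else if i = 2 \<and> j = 2 then \<sigma> $ 1 $ 1 else if i = 2 \<and> j = 3 then \<sigma> $ 1 $ 2
     else if i = 3 \<and> j = 2 then \<sigma> $ 2 $ 1 else if i = 3 \<and> j = 3 then \<sigma> $ 2 $ 2 else 0)"

lemma det_adapted: "det (adapted \<sigma>) = - det \<sigma>"
  by (simp add: det_4 det_2 adapted_def)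

lemma adapted_inverse:
  assumes "\<sigma> ** \<rho> = mat 1"
  shows "adapted \<sigma> ** adapted \<rho> = mat 1"
  using assms
  by (simp add: vec_eq_iff all_4 forall_2 matrix_matrix_mult_def sum_UNIV_4 sum_2 adapted_def mat_def)

lemma slice2_axis: "slice2 (axis 1 1) = axis 2 1" "slice2 (axis 2 1) = axis 3 1"
  by (simp_all add: slice2_def vec_eq_iff all_4 axis_def)

text \<open>Only the part of \<open>\<tau>\<close> that is antisymmetric in the two slots of the volume form
  survives, and there the unit normal has to occur exactly once.\<close>

lemma cnt_contraction:
  fixes P :: "real^4^4" and D :: "real^4 \<Rightarrow> real^4 \<Rightarrow> real^4 \<Rightarrow> real"
  assumes D: "\<And>X. bilinear (D X)" "\<And>v w. linear (\<lambda>X. D X v w)" "\<And>X v w. D X v w = D X w v"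
    and tan: "\<And>v w. D (axis 2 1) v w = 0" "\<And>v w. D (axis 3 1) v w = 0"
    and gram: "transpose P ** M ** P = adapted \<sigma>" and \<sigma>: "det \<sigma> > 0" "transpose \<sigma> = \<sigma>" and P: "det P > 0"
    and col: "column 0 P = E0" "column 1 P = E1" "column 2 P = axis 2 1" "column 3 P = axis 3 1"
    and C: "\<And>a m b. C a m b = 1/2 * (\<Sum>d\<in>UNIV. matrix_inv M $ a $ d *
      (D (axis m 1) (axis d 1) (axis b 1) + D (axis b 1) (axis d 1) (axis m 1)
        - D (axis d 1) (axis m 1) (axis b 1)))"
  shows "(\<Sum>a\<in>UNIV. \<Sum>b\<in>UNIV. C a 2 b * eta_form M a b E0 (axis 3 1) - C a 3 b * eta_form M a b E0 (axis 2 1)) =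
    - sqrt (det \<sigma>) * (\<Sum>A\<in>UNIV. \<Sum>B\<in>UNIV. matrix_inv \<sigma> $ A $ B *
      D E1 (slice2 (axis A 1)) (slice2 (axis B 1)))"
proof -
  let ?R = "adapted (matrix_inv \<sigma>)"
  have inv: "matrix_inv M = P ** ?R ** transpose P"
    by (rule matrix_inv_congruence[OF gram])
      (use \<sigma> in \<open>simp add: adapted_inverse matrix_inv_cancel\<close>)
  \<comment> \<open>With \<open>E0\<close> and one tangent vector filling the last two slots, the
    first two must hold \<open>E1\<close> and the other tangent vector, in either order.\<close>
  have vol1: "vol E1 (axis 2 1) E0 (axis 3 1) = det P" "vol E1 (axis 3 1) E0 (axis 2 1) = - det P"
    "vol (axis 2 1) E1 E0 (axis 3 1) = - det P" "vol (axis 3 1) E1 E0 (axis 2 1) = det P"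
  proof -
    have "(\<chi> i. if i = 0 then E0 else if i = 1 then E1 else if i = 2 then axis 2 1 else axis 3 1) = transpose P"
      using col by (simp add: vec_eq_iff all_4 transpose_def column_def)
    then have "vol E0 E1 (axis 2 1) (axis 3 1) = det P"
      by (simp add: vol_def)
    then show "vol E1 (axis 2 1) E0 (axis 3 1) = det P" "vol E1 (axis 3 1) E0 (axis 2 1) = - det P"
      "vol (axis 2 1) E1 E0 (axis 3 1) = - det P" "vol (axis 3 1) E1 E0 (axis 2 1) = det P"
      by (simp_all add: vol_expand algebra_simps)
  qed
  have "det (transpose P ** M ** P) = - det \<sigma>" by (simp add: gram det_adapted)
  then have "det \<sigma> = - det M * (det P)\<^sup>2" by (simp add: det_mul power2_eq_square algebra_simps)
  \<comment> \<open>The spacetime density times the determinant of the frame is the area density of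
    the surface.\<close>
  then have s: "sqrt (det \<sigma>) = sqrt (- det M) * det P"
    using P by (metis real_sqrt_mult real_sqrt_abs abs_of_pos)
  have "transpose (matrix_inv \<sigma>) = matrix_inv \<sigma>"
  proof (rule matrix_inv_eq[symmetric])
    show "\<sigma> ** transpose (matrix_inv \<sigma>) = mat 1"
      using \<sigma> matrix_inv_cancel(2)[of \<sigma>] matrix_transpose_mul[of "matrix_inv \<sigma>" \<sigma>]
      by (simp add: transpose_mat)
  qed
  then have sym: "matrix_inv \<sigma> $ 2 $ 1 = matrix_inv \<sigma> $ 1 $ 2"
    by (simp add: vec_eq_iff transpose_def)
  \<comment> \<open>Twice the lowered difference of the connections. For tangent \<open>m\<close>
    the first term vanishes, and the symmetry of \<open>D\<close> makes the other two antisymmetric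
    in \<open>v\<close> and \<open>w\<close>.\<close>
  define \<tau> where "\<tau> m v w = D (axis m 1) v w + D w v (axis m 1) - D v (axis m 1) w" for m v w
  have bt: "bilinear (\<tau> m)" for m
    using D(1,2) by (auto simp: bilinear_def linear_iff \<tau>_def algebra_simps)
  have contr: "(\<Sum>a\<in>UNIV. \<Sum>b\<in>UNIV. C a m b * eta_form M a b E0 X) = 1/2 * sqrt (- det M) *
    (\<Sum>i\<in>UNIV. \<Sum>j\<in>UNIV. \<Sum>k\<in>UNIV. \<Sum>l\<in>UNIV. ?R $ i $ j * ?R $ k $ l *
      (\<tau> m (column j P) (column k P) * vol (column i P) (column l P) E0 X))" for m X
    unfolding double_contraction[OF bt bilinear_vol(1) inv, symmetric]
    unfolding C eta_form_eq \<tau>_def sum_distrib_left[of "1/2 * sqrt (- det M)"]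
    by (simp add: mult_ac)
  \<comment> \<open>The two positions of \<open>E1\<close> in the volume form contribute equally,
    which cancels the 1/2 of the Christoffel symbols.\<close>
  have "(\<Sum>a\<in>UNIV. \<Sum>b\<in>UNIV. C a 2 b * eta_form M a b E0 (axis 3 1)) =
    - sqrt (det \<sigma>) * (\<Sum>B\<in>UNIV. matrix_inv \<sigma> $ 1 $ B * D E1 (axis 2 1) (slice2 (axis B 1)))"
    unfolding contr
    by (simp add: sum_UNIV_4 sum_2 adapted_def col vol_same vol1 s \<tau>_def tan slice2_axis sym
      D(3)[of _ "axis 3 1" "axis 2 1"]) (simp add: algebra_simps)?
  moreover have "(\<Sum>a\<in>UNIV. \<Sum>b\<in>UNIV. C a 3 b * eta_form M a b E0 (axis 2 1)) =
    sqrt (det \<sigma>) * (\<Sum>B\<in>UNIV. matrix_inv \<sigma> $ 2 $ B * D E1 (axis 3 1) (slice2 (axis B 1)))"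
    unfolding contr
    by (simp add: sum_UNIV_4 sum_2 adapted_def col vol_same vol1 s \<tau>_def tan slice2_axis sym
      D(3)[of _ "axis 3 1" "axis 2 1"]) (simp add: algebra_simps)?
  ultimately show ?thesis
    by (simp add: sum_subtractf sum_2 slice2_axis algebra_simps)
qed

section \<open>Calculus\<close>

abbreviation fd :: "('a::real_normed_vector \<Rightarrow> 'b::real_normed_vector) \<Rightarrow> 'a \<Rightarrow> 'a \<Rightarrow> 'b" where
  "fd f x \<equiv> frechet_derivative f (at x)"

lemma fd_eq: "(f has_derivative f') (at x) \<Longrightarrow> fd f x = f'"
  by (rule frechet_derivative_at[symmetric])

lemma has_derivative_fd: "f differentiable (at x) \<Longrightarrow> (f has_derivative fd f x) (at x)"
  by (simp add: frechet_derivative_works)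

lemma linear_fd: "f differentiable (at x) \<Longrightarrow> linear (fd f x)"
  by (metis has_derivative_fd has_derivative_linear)

lemma has_derivative_cong_open:
  assumes "open V" "x \<in> V" "\<And>y. y \<in> V \<Longrightarrow> f y = g y"
  shows "(f has_derivative f') (at x) \<longleftrightarrow> (g has_derivative f') (at x)"
  using has_derivative_transform_within_open[OF _ assms(1,2)] assms(3) by metis

lemma fd_cong_open:
  assumes "open V" "x \<in> V" "\<And>y. y \<in> V \<Longrightarrow> f y = g y"
  shows "fd f x = fd g x"
  unfolding frechet_derivative_def using has_derivative_cong_open[OF assms] by simp

lemma differentiable_cong_open:
  assumes "open V" "x \<in> V" "\<And>y. y \<in> V \<Longrightarrow> f y = g y"
  shows "f differentiable (at x) \<longleftrightarrow> g differentiable (at x)"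
  unfolding differentiable_def using has_derivative_cong_open[OF assms] by simp

lemma fd_compose:
  assumes "f differentiable (at x)" "g differentiable (at (f x))"
  shows "fd (\<lambda>x. g (f x)) x = (\<lambda>v. fd g (f x) (fd f x v))"
  using diff_chain_at[OF has_derivative_fd[OF assms(1)] has_derivative_fd[OF assms(2)]]
  by (intro fd_eq) (simp add: o_def)

lemma fd_linear_compose:
  assumes "f differentiable (at x)" "bounded_linear L"
  shows "fd (\<lambda>x. L (f x)) x v = L (fd f x v)"
  using fd_eq[OF bounded_linear.has_derivative[OF assms(2) has_derivative_fd[OF assms(1)]]] by simp

lemma fd_vec_nth:
  assumes "f differentiable (at x)"
  shows "fd (\<lambda>x. f x $ i) x v = fd f x v $ i"
  using fd_linear_compose[OF assms bounded_linear_vec_nth] .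

lemma differentiable_vec_nth:
  "f differentiable (at x) \<Longrightarrow> (\<lambda>x. f x $ i) differentiable (at x)"
  unfolding differentiable_def using bounded_linear.has_derivative[OF bounded_linear_vec_nth] by blast

lemma linear_axis_expansion:
  fixes L :: "real^'n \<Rightarrow> 'b::real_vector"
  assumes "linear L"
  shows "L v = (\<Sum>i\<in>UNIV. v $ i *\<^sub>R L (axis i 1))"
proof -
  have "L v = L (\<Sum>i\<in>UNIV. v $ i *\<^sub>R axis i 1)"
    using basis_expansion[of v] by (simp add: scalar_mult_eq_scaleR)
  then show ?thesis by (simp add: linear_sum[OF assms] linear_cmul[OF assms])
qed

section \<open>Twice differentiable maps\<close>

text \<open>First derivatives of pulled-back metrics involve maps only up to second order. As in
  \<open>Ck_on\<close>, the second order is stated for each fixed direction, which avoids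
  derivatives with values in a space of linear maps.\<close>

definition twice_differentiable_on ::
    "'a::real_normed_vector set \<Rightarrow> ('a \<Rightarrow> 'b::real_normed_vector) \<Rightarrow> bool" where
  "twice_differentiable_on V f \<longleftrightarrow> (\<forall>x\<in>V. f differentiable (at x)) \<and>
     (\<forall>v. \<forall>x\<in>V. (\<lambda>y. fd f y v) differentiable (at x))"

lemma twice_differentiable_onD:
  assumes "twice_differentiable_on V f" "x \<in> V"
  shows "f differentiable (at x)" "(\<lambda>y. fd f y v) differentiable (at x)"
  using assms by (auto simp: twice_differentiable_on_def)

lemma smooth_on_imp_twice_differentiable_on:
  assumes "smooth_on V f"
  shows "twice_differentiable_on V f"
proof -
  have "Ck_on (Suc (Suc 0)) f V" using assms unfolding smooth_on_def by blast
  then show ?thesis by (simp add: twice_differentiable_on_def)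
qed

lemma twice_differentiable_on_subset:
  "twice_differentiable_on V f \<Longrightarrow> W \<subseteq> V \<Longrightarrow> twice_differentiable_on W f"
  by (auto simp: twice_differentiable_on_def)

lemma twice_differentiable_on_cong:
  assumes "open V" "\<And>y. y \<in> V \<Longrightarrow> f y = g y" "twice_differentiable_on V f"
  shows "twice_differentiable_on V g"
proof -
  have eq: "fd f y v = fd g y v" if "y \<in> V" for y v
    using fd_cong_open[OF assms(1) that assms(2)] by simp
  show ?thesis
    unfolding twice_differentiable_on_def
    using assms differentiable_cong_open[OF assms(1) _ assms(2)]
      differentiable_cong_open[OF assms(1) _ eq] by (auto simp: twice_differentiable_on_def)
qed

text \<open>In the chain rule both the base point and the direction of the derivative of
  \<open>g\<close> move with \<open>y\<close>, whereas the definition controls only fixed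
  directions. Expanding the direction in the standard basis of \<open>real^'n\<close> separates the
  two.\<close>

lemma twice_differentiable_on_compose:
  fixes f :: "'a::real_normed_vector \<Rightarrow> real^'n"
  assumes "open V" "twice_differentiable_on V f" "twice_differentiable_on W g" "f ` V \<subseteq> W"
  shows "twice_differentiable_on V (\<lambda>x. g (f x))"
  unfolding twice_differentiable_on_def
proof (intro conjI ballI allI)
  have f: "f differentiable (at x)" "(\<lambda>y. fd f y v) differentiable (at x)" 
    and g: "g differentiable (at (f x))" "(\<lambda>y. fd g y w) differentiable (at (f x))" if "x \<in> V" for x v w
    using that assms twice_differentiable_onD by blast+
  fix x assume x: "x \<in> V"
  show "(\<lambda>x. g (f x)) differentiable (at x)"
    using differentiable_chain_at[OF f(1) g(1)] x by (simp add: o_def)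
  fix v
  have eq: "fd (\<lambda>x. g (f x)) y v = (\<Sum>i\<in>UNIV. fd f y v $ i *\<^sub>R fd g (f y) (axis i 1))" if "y \<in> V" for y
    using fd_compose[OF f(1) g(1)] linear_axis_expansion[OF linear_fd[OF g(1)]] that by simp
  have "(\<lambda>y. \<Sum>i\<in>UNIV. fd f y v $ i *\<^sub>R fd g (f y) (axis i 1)) differentiable (at x)"
    using differentiable_chain_at[OF f(1) g(2)] x
    by (intro differentiable_sum ballI differentiable_scaleR differentiable_vec_nth f) (auto simp: o_def)
  then show "(\<lambda>y. fd (\<lambda>x. g (f x)) y v) differentiable (at x)"
    using differentiable_cong_open[OF assms(1) x eq] by simp
qed

lemma twice_differentiable_on_linear:
  assumes "bounded_linear L"
  shows "twice_differentiable_on V L"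
proof -
  have "fd L y = L" for y
    using assms by (intro fd_eq bounded_linear_imp_has_derivative)
  then show ?thesis
    using assms unfolding twice_differentiable_on_def
    by (auto intro: bounded_linear_imp_differentiable)
qed

text \<open>The mean value theorem expresses the second difference quotient through the increment of
  the derivative in direction \<open>v\<close>; as it is symmetric in \<open>v\<close> and \<open>w\<close>, so is the limit.\<close>

lemma second_difference_tendsto:
  fixes f :: "'a::real_normed_vector \<Rightarrow> real"
  assumes V: "open V" "x \<in> V" and f: "\<And>y. y \<in> V \<Longrightarrow> f differentiable (at y)"
    and \<phi>: "((\<lambda>y. fd f y v) has_derivative \<phi>') (at x)"
  shows "((\<lambda>t. (f (x + t *\<^sub>R v + t *\<^sub>R w) - f (x + t *\<^sub>R v) - f (x + t *\<^sub>R w) + f x) / t\<^sup>2)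
    \<longlongrightarrow> \<phi>' w) (at_right 0)"
proof (rule tendstoI)
  fix e :: real assume e: "e > 0"
  \<comment> \<open>\<open>t * C\<close> bounds every displacement inside the parallelogram spanned
    by \<open>t *\<^sub>R v\<close> and \<open>t *\<^sub>R w\<close>; the summand 1 keeps
    \<open>C\<close> positive when both vectors vanish.\<close>
  define C where "C = norm v + norm w + 1"
  have C: "C > 0" by (simp add: C_def add_nonneg_pos)
  have lin: "linear \<phi>'" using \<phi> has_derivative_linear by blast
  obtain \<delta>1 where \<delta>1: "\<delta>1 > 0" "ball x \<delta>1 \<subseteq> V" using V openE by blast
  \<comment> \<open>Two linearisation errors of size at most \<open>e * t / 4\<close> each will add
    up to less than \<open>e * t\<close>.\<close>
  have "0 < e / (4 * C)" using e C by simp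
  then obtain \<delta>2 where \<delta>2: "\<delta>2 > 0" "\<And>y. norm (y - x) < \<delta>2 \<Longrightarrow>
      norm (fd f y v - fd f x v - \<phi>' (y - x)) \<le> e / (4 * C) * norm (y - x)"
    using \<phi> unfolding has_derivative_at_alt by blast
  define \<delta> where "\<delta> = min \<delta>1 \<delta>2 / C"
  have "\<delta> > 0" using \<delta>1 \<delta>2 C by (simp add: \<delta>_def)
  have "dist ((f (x + t *\<^sub>R v + t *\<^sub>R w) - f (x + t *\<^sub>R v) - f (x + t *\<^sub>R w) + f x) / t\<^sup>2) (\<phi>' w) < e"
    if t: "0 < t" "t < \<delta>" for t
  proof -
    have tC: "t * C < min \<delta>1 \<delta>2" using t C by (simp add: \<delta>_def field_simps)
    have bd: "norm (s *\<^sub>R v + r *\<^sub>R w) \<le> t * C" if "0 \<le> s" "s \<le> t" "0 \<le> r" "r \<le> t" for s r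
    proof -
      have "norm (s *\<^sub>R v + r *\<^sub>R w) \<le> s * norm v + r * norm w"
        using that by (metis norm_triangle_ineq norm_scaleR abs_of_nonneg)
      also have "\<dots> \<le> t * norm v + t * norm w"
        using that by (intro add_mono mult_right_mono) auto
      also have "\<dots> \<le> t * C" using t by (simp add: C_def algebra_simps)
      finally show ?thesis .
    qed
    have inV: "x + s *\<^sub>R v + r *\<^sub>R w \<in> V" if "0 \<le> s" "s \<le> t" "0 \<le> r" "r \<le> t" for s r
    proof -
      have "dist x (x + s *\<^sub>R v + r *\<^sub>R w) = norm (s *\<^sub>R v + r *\<^sub>R w)"
        by (metis add.assoc add_diff_cancel_left' dist_commute dist_norm)
      then show ?thesis using bd[OF that] tC \<delta>1(2) by auto
    qed
    define h where "h s = f (x + s *\<^sub>R v + t *\<^sub>R w) - f (x + s *\<^sub>R v)" for s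
    have hd: "(h has_derivative (\<lambda>k. k * (fd f (x + s *\<^sub>R v + t *\<^sub>R w) v - fd f (x + s *\<^sub>R v) v))) (at s)"
      if "0 \<le> s" "s \<le> t" for s
    proof -
      have *: "((\<lambda>s. f (x + s *\<^sub>R v + r *\<^sub>R w)) has_derivative
          (\<lambda>k. k * fd f (x + s *\<^sub>R v + r *\<^sub>R w) v)) (at s)" if "0 \<le> r" "r \<le> t" for r
      proof -
        have fdiff: "f differentiable (at (x + s *\<^sub>R v + r *\<^sub>R w))"
          using f inV \<open>0 \<le> s\<close> \<open>s \<le> t\<close> that by blast
        have "((\<lambda>s. x + s *\<^sub>R v + r *\<^sub>R w) has_derivative (\<lambda>k. k *\<^sub>R v)) (at s)"
          by (auto intro!: derivative_eq_intros)
        from diff_chain_at[OF this has_derivative_fd[OF fdiff]]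
        show ?thesis
          using linear_cmul[OF linear_fd[OF fdiff]] by (simp add: o_def)
      qed
      show ?thesis
        unfolding h_def using has_derivative_diff[OF *[of t] *[of 0]] t
        by (simp add: algebra_simps)
    qed
    have "continuous_on {0..t} h"
      using has_derivative_continuous[OF hd] by (intro continuous_at_imp_continuous_on) auto
    from mvt[OF t(1) this hd] obtain \<xi> where \<xi>: "0 < \<xi>" "\<xi> < t"
      "h t - h 0 = (t - 0) * (fd f (x + \<xi> *\<^sub>R v + t *\<^sub>R w) v - fd f (x + \<xi> *\<^sub>R v) v)"
      by auto
    let ?a = "\<xi> *\<^sub>R v + t *\<^sub>R w" let ?b = "\<xi> *\<^sub>R v"
    have e1: "\<bar>fd f (x + ?a) v - fd f x v - \<phi>' ?a\<bar> \<le> e / (4 * C) * (t * C)"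
    proof -
      have "norm ?a \<le> t * C" using bd[of \<xi> t] \<xi> t by simp
      moreover have "\<bar>fd f (x + ?a) v - fd f x v - \<phi>' ?a\<bar> \<le> e / (4 * C) * norm ?a"
        using \<delta>2(2)[of "x + ?a"] calculation tC by simp
      ultimately show ?thesis
        using e C by (meson order_trans mult_left_mono divide_nonneg_pos less_imp_le mult_pos_pos zero_less_numeral)
    qed
    have e2: "\<bar>fd f (x + ?b) v - fd f x v - \<phi>' ?b\<bar> \<le> e / (4 * C) * (t * C)"
    proof -
      have "norm ?b \<le> t * C" using bd[of \<xi> 0] \<xi> t by simp
      moreover have "\<bar>fd f (x + ?b) v - fd f x v - \<phi>' ?b\<bar> \<le> e / (4 * C) * norm ?b"
        using \<delta>2(2)[of "x + ?b"] calculation tC by simp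
      ultimately show ?thesis
        using e C by (meson order_trans mult_left_mono divide_nonneg_pos less_imp_le mult_pos_pos zero_less_numeral)
    qed
    have "\<phi>' ?a - \<phi>' ?b = t * \<phi>' w"
      using linear_diff[OF lin, of ?a ?b] linear_cmul[OF lin, of t w] by simp
    then have "\<bar>(fd f (x + ?a) v - fd f (x + ?b) v) - t * \<phi>' w\<bar> \<le> 2 * (e / (4 * C) * (t * C))"
      using e1 e2 by linarith
    also have "\<dots> < e * t" using C e t by (simp add: field_simps)
    finally have "\<bar>(h t - h 0) / t - t * \<phi>' w\<bar> < e * t"
      using \<xi>(3) t by (simp add: add.assoc)
    then have "\<bar>((h t - h 0) / t - t * \<phi>' w) / t\<bar> < e"
      using t by (simp add: abs_divide divide_less_eq)
    moreover have "((h t - h 0) / t - t * \<phi>' w) / t = (h t - h 0) / t\<^sup>2 - \<phi>' w"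
      using t by (simp add: field_simps power2_eq_square)
    moreover have "h t - h 0 = f (x + t *\<^sub>R v + t *\<^sub>R w) - f (x + t *\<^sub>R v) - f (x + t *\<^sub>R w) + f x"
      by (simp add: h_def)
    ultimately show ?thesis by (simp only: dist_real_def)
  qed
  then show "\<forall>\<^sub>F t in at_right 0. dist ((f (x + t *\<^sub>R v + t *\<^sub>R w) - f (x + t *\<^sub>R v) - f (x + t *\<^sub>R w) + f x) / t\<^sup>2) (\<phi>' w) < e"
    using \<open>\<delta> > 0\<close> by (auto simp: eventually_at_right_field)
qed

lemma second_derivative_symmetric_real:
  fixes f :: "'a::real_normed_vector \<Rightarrow> real"
  assumes V: "open V" "x \<in> V" and f: "twice_differentiable_on V f"
  shows "fd (\<lambda>y. fd f y v) x w = fd (\<lambda>y. fd f y w) x v"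
proof -
  note d = twice_differentiable_onD[OF f]
  let ?q = "\<lambda>t. (f (x + t *\<^sub>R v + t *\<^sub>R w) - f (x + t *\<^sub>R v) - f (x + t *\<^sub>R w) + f x) / t\<^sup>2"
  have "(?q \<longlongrightarrow> fd (\<lambda>y. fd f y v) x w) (at_right 0)"
    by (rule second_difference_tendsto[OF V d(1) has_derivative_fd[OF d(2)[OF V(2)]]])
  moreover have "(?q \<longlongrightarrow> fd (\<lambda>y. fd f y w) x v) (at_right 0)"
    using second_difference_tendsto[OF V d(1) has_derivative_fd[OF d(2)[OF V(2)]], of w v]
    by (simp add: algebra_simps)
  ultimately show ?thesis by (rule tendsto_unique[rotated]) simp
qed

lemma second_derivative_symmetric:
  fixes f :: "'a::real_normed_vector \<Rightarrow> real^'n"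
  assumes V: "open V" "x \<in> V" and f: "twice_differentiable_on V f"
  shows "fd (\<lambda>y. fd f y v) x w = fd (\<lambda>y. fd f y w) x v"
proof -
  note d = twice_differentiable_onD[OF f]
  have eq: "fd (\<lambda>y. f y $ i) y u = fd f y u $ i" if "y \<in> V" for y u i
    using fd_vec_nth[OF d(1)[OF that]] .
  have "twice_differentiable_on V (\<lambda>y. f y $ i)" for i
    unfolding twice_differentiable_on_def
    using d differentiable_cong_open[OF V(1) _ eq] by (auto intro: differentiable_vec_nth)
  note sym = second_derivative_symmetric_real[OF V this]
  have "fd (\<lambda>y. fd (\<lambda>y. f y $ i) y u) x = fd (\<lambda>y. fd f y u $ i) x" for i u
    by (rule fd_cong_open[OF V]) (rule eq)
  with sym have "fd (\<lambda>y. fd f y v $ i) x w = fd (\<lambda>y. fd f y w $ i) x v" for i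
    by metis
  then show ?thesis
    by (simp add: vec_eq_iff fd_vec_nth[OF d(2)[OF V(2)]])
qed

text \<open>The chain rule for second derivatives has an extra term, the first derivative of
  \<open>r\<close> applied to the second derivative of \<open>f\<close>. It vanishes at a critical
  point of \<open>r\<close>, so the Hessian there changes like a bilinear form.\<close>

lemma hessian_compose_critical:
  fixes f :: "'a::real_normed_vector \<Rightarrow> real^'n" and r :: "real^'n \<Rightarrow> real"
  assumes V: "open V" "x \<in> V" and f: "twice_differentiable_on V f"
    and W: "open W" and r: "twice_differentiable_on W r" "f ` V \<subseteq> W"
    and crit: "\<And>u. fd r (f x) u = 0"
  shows "fd (\<lambda>y. fd (\<lambda>y. r (f y)) y v) x w = fd (\<lambda>z. fd r z (fd f x v)) (f x) (fd f x w)"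
proof -
  note df = twice_differentiable_onD[OF f]
  have dr: "r differentiable (at (f y))" "(\<lambda>z. fd r z u) differentiable (at (f y))" if "y \<in> V" for y u
    using that r twice_differentiable_onD by blast+
  have eq: "fd (\<lambda>x. r (f x)) y v = (\<Sum>i\<in>UNIV. fd f y v $ i * fd r (f y) (axis i 1))" if "y \<in> V" for y
    using fd_compose[OF df(1) dr(1)] linear_axis_expansion[OF linear_fd[OF dr(1)]] that by simp
  have "((\<lambda>y. \<Sum>i\<in>UNIV. fd f y v $ i * fd r (f y) (axis i 1)) has_derivative
     (\<lambda>w. \<Sum>i\<in>UNIV. fd f x v $ i * fd (\<lambda>z. fd r z (axis i 1)) (f x) (fd f x w))) (at x)"
  proof (rule has_derivative_sum)
    fix i :: 'n
    have "((\<lambda>y. fd r (f y) (axis i 1)) has_derivative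
        (\<lambda>w. fd (\<lambda>z. fd r z (axis i 1)) (f x) (fd f x w))) (at x)"
      using diff_chain_at[OF has_derivative_fd[OF df(1)[OF V(2)]] has_derivative_fd[OF dr(2)[OF V(2)]]]
      by (simp add: o_def)
    from has_derivative_mult[OF has_derivative_fd[OF differentiable_vec_nth[OF df(2)[OF V(2)]]] this]
    show "((\<lambda>y. fd f y v $ i * fd r (f y) (axis i 1)) has_derivative
      (\<lambda>w. fd f x v $ i * fd (\<lambda>z. fd r z (axis i 1)) (f x) (fd f x w))) (at x)"
      by (simp add: crit)
  qed
  then have "fd (\<lambda>y. fd (\<lambda>x. r (f x)) y v) x w =
      (\<Sum>i\<in>UNIV. fd f x v $ i * fd (\<lambda>z. fd r z (axis i 1)) (f x) (fd f x w))"
    using fd_cong_open[OF V eq] by (simp add: fd_eq)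
  also have "\<dots> = fd (\<lambda>z. \<Sum>i\<in>UNIV. fd f x v $ i * fd r z (axis i 1)) (f x) (fd f x w)"
  proof -
    have "((\<lambda>z. \<Sum>i\<in>UNIV. fd f x v $ i * fd r z (axis i 1)) has_derivative
      (\<lambda>u. \<Sum>i\<in>UNIV. fd f x v $ i * fd (\<lambda>z. fd r z (axis i 1)) (f x) u)) (at (f x))"
      by (intro has_derivative_sum has_derivative_mult_right has_derivative_fd dr V)
    then show ?thesis by (simp add: fd_eq)
  qed
  also have "\<dots> = fd (\<lambda>z. fd r z (fd f x v)) (f x) (fd f x w)"
  proof -
    have "(\<Sum>i\<in>UNIV. fd f x v $ i * fd r z (axis i 1)) = fd r z (fd f x v)" if "z \<in> W" for z
      unfolding real_scaleR_def[symmetric]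
      by (rule linear_axis_expansion[OF linear_fd[OF twice_differentiable_onD(1)[OF r(1) that]], symmetric])
    moreover have "f x \<in> W" using r(2) V(2) by blast
    ultimately have "fd (\<lambda>z. \<Sum>i\<in>UNIV. fd f x v $ i * fd r z (axis i 1)) (f x) = fd (\<lambda>z. fd r z (fd f x v)) (f x)"
      by (intro fd_cong_open[OF W])
    then show ?thesis by (rule fun_cong)
  qed
  finally show ?thesis .
qed

section \<open>Charts\<close>

lemma is_chartD:
  assumes "is_chart c"
  shows "open (fst c)" "\<And>p. p \<in> fst c \<Longrightarrow> chart_inv c (snd c p) = p"
    "\<And>y. y \<in> snd c ` fst c \<Longrightarrow> snd c (chart_inv c y) = y"
    "\<And>y. y \<in> snd c ` fst c \<Longrightarrow> chart_inv c y \<in> fst c"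
    "continuous_on (fst c) (snd c)" "continuous_on (snd c ` fst c) (chart_inv c)" "open (snd c ` fst c)"
  using assms unfolding is_chart_def homeomorphism_def by auto

lemma open_chart_image:
  assumes "is_chart c" "open W"
  shows "open (snd c ` (fst c \<inter> W))"
proof -
  have "snd c ` (fst c \<inter> W) = chart_inv c -` W \<inter> snd c ` fst c"
    using is_chartD[OF assms(1)] by force
  then show ?thesis
    using continuous_on_open_vimage is_chartD(6,7)[OF assms(1)] assms(2) by metis
qed

lemma oriented_charts_is_chart: "c \<in> oriented_charts A \<Longrightarrow> is_chart c"
  by (simp add: oriented_charts_def)

lemma oriented_atlas_obtains:
  assumes "oriented_atlas A"
  obtains e where "e \<in> A" "p \<in> fst e"
  using assms unfolding oriented_atlas_def by blast

text \<open>Charts of the maximal atlas are by definition compatible only with charts of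
  \<open>A\<close>. Near each point the transition map therefore has to be factored through a chart
  \<open>e\<close> of \<open>A\<close>; differentiability is local, so this suffices.\<close>

lemma transition_twice_differentiable:
  fixes A :: "('m::topological_space) chart set"
  assumes A: "oriented_atlas A" and cd: "c \<in> oriented_charts A" "d \<in> oriented_charts A"
  shows "twice_differentiable_on (snd c ` (fst c \<inter> fst d)) (\<lambda>y. snd d (chart_inv c y))"
proof -
  note c = is_chartD[OF oriented_charts_is_chart[OF cd(1)]]
  note d = is_chartD[OF oriented_charts_is_chart[OF cd(2)]]
  have "\<exists>W. x \<in> W \<and> twice_differentiable_on W (\<lambda>y. snd d (chart_inv c y))"
    if x: "x \<in> snd c ` (fst c \<inter> fst d)" for x
  proof -
    obtain p where p: "p \<in> fst c" "p \<in> fst d" "x = snd c p" using x by blast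
    obtain e where e: "e \<in> A" "p \<in> fst e" using A oriented_atlas_obtains by blast
    have ce: "oriented_compatible c e" and de: "oriented_compatible d e"
      using cd e(1) by (auto simp: oriented_charts_def)
    have ech: "is_chart e" using A e(1) by (auto simp: oriented_atlas_def)
    note ee = is_chartD[OF ech]
    let ?W = "snd c ` (fst c \<inter> (fst d \<inter> fst e))"
    have W: "open ?W"
      using c(1) d(1) ee(1) open_chart_image[OF oriented_charts_is_chart[OF cd(1)], of "fst d \<inter> fst e"] by auto
    have 1: "twice_differentiable_on ?W (\<lambda>y. snd e (chart_inv c y))"
    proof (rule twice_differentiable_on_subset)
      show "twice_differentiable_on (snd c ` (fst c \<inter> fst e)) (\<lambda>y. snd e (chart_inv c y))"
        using ce unfolding oriented_compatible_def o_def by (intro smooth_on_imp_twice_differentiable_on) simp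
    qed auto
    have 2: "twice_differentiable_on (snd e ` (fst d \<inter> fst e)) (\<lambda>y. snd d (chart_inv e y))"
      using de unfolding oriented_compatible_def o_def by (intro smooth_on_imp_twice_differentiable_on) simp
    have im: "(\<lambda>y. snd e (chart_inv c y)) ` ?W \<subseteq> snd e ` (fst d \<inter> fst e)" using c(2) by auto
    have "twice_differentiable_on ?W (\<lambda>y. snd d (chart_inv e (snd e (chart_inv c y))))"
      by (rule twice_differentiable_on_compose[OF W 1 2 im])
    then have "twice_differentiable_on ?W (\<lambda>y. snd d (chart_inv c y))"
    proof (rule twice_differentiable_on_cong[OF W, rotated])
      fix y assume "y \<in> ?W"
      then obtain q where "q \<in> fst c" "q \<in> fst e" "y = snd c q" by blast
      then show "snd d (chart_inv e (snd e (chart_inv c y))) = snd d (chart_inv c y)"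
        using c(2) ee(2) by simp
    qed
    moreover have "x \<in> ?W" using p e by blast
    ultimately show ?thesis by (intro exI conjI)
  qed
  then show ?thesis
    unfolding twice_differentiable_on_def[of "snd c ` (fst c \<inter> fst d)"]
    using twice_differentiable_onD by fast
qed

lemma transition_domain:
  assumes "c \<in> oriented_charts A" "d \<in> oriented_charts A" "p \<in> fst c \<inter> fst d"
  shows "open (snd c ` (fst c \<inter> fst d))" "snd c p \<in> snd c ` (fst c \<inter> fst d)"
    "chart_inv c (snd c p) = p"
  using assms open_chart_image is_chartD(1,2) oriented_charts_is_chart by blast+

lemma jac_mult:
  fixes A :: "('m::topological_space) chart set"
  assumes "oriented_atlas A" "c \<in> oriented_charts A" "d \<in> oriented_charts A" "p \<in> fst c \<inter> fst d"
  shows "jac c d p *v v = fd (\<lambda>y. snd d (chart_inv c y)) (snd c p) v"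
proof -
  have "(\<lambda>y. snd d (chart_inv c y)) differentiable (at (snd c p))"
    using twice_differentiable_onD(1)[OF transition_twice_differentiable[OF assms(1-3)]] transition_domain[OF assms(2-4)]
    by blast
  then show ?thesis
    unfolding jac_def o_def by (simp add: matrix_works linear_matrix_vector_mul_eq linear_fd)
qed

lemma jac_inverse:
  fixes A :: "('m::topological_space) chart set"
  assumes "oriented_atlas A" "c \<in> oriented_charts A" "d \<in> oriented_charts A" "p \<in> fst c \<inter> fst d"
  shows "jac c d p *v (jac d c p *v v) = v"
proof -
  have p': "p \<in> fst d \<inter> fst c" using assms by blast
  note D = transition_domain[OF assms(3,2) p'] and C = transition_domain[OF assms(2-4)]
  have dd: "(\<lambda>y. snd c (chart_inv d y)) differentiable (at (snd d p))"
    using twice_differentiable_onD(1)[OF transition_twice_differentiable[OF assms(1,3,2)]] D by blast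
  have dc: "(\<lambda>y. snd d (chart_inv c y)) differentiable (at (snd c (chart_inv d (snd d p))))"
    using twice_differentiable_onD(1)[OF transition_twice_differentiable[OF assms(1-3)]] D C by simp
  have "fd (\<lambda>y. snd d (chart_inv c (snd c (chart_inv d y)))) (snd d p) = fd (\<lambda>y. y) (snd d p)"
    by (rule fd_cong_open[OF D(1,2)])
      (use is_chartD(2)[OF oriented_charts_is_chart[OF assms(2)]] is_chartD(2)[OF oriented_charts_is_chart[OF assms(3)]] in auto)
  also have "\<dots> = (\<lambda>v. v)" by (rule fd_eq) (rule has_derivative_ident)
  finally show ?thesis
    using fun_cong[OF fd_compose[OF dd dc], of v] D(3) jac_mult[OF assms] jac_mult[OF assms(1,3,2) p'] by simp
qed

section \<open>Partitions of unity\<close>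

text \<open>The function is a truncated distance in coordinates, extended by zero. In a Hausdorff
  space the compact preimage of a closed coordinate ball is closed, so the two pieces are continuous
  on open sets that cover everything.\<close>

lemma chart_bump:
  fixes c :: "('m::t2_space) chart"
  assumes c: "is_chart c" and p: "p \<in> fst c"
  obtains b :: "'m \<Rightarrow> real" where "continuous_on UNIV b" "\<And>q. b q \<ge> 0" "b p > 0" "closure {q. b q \<noteq> 0} \<subseteq> fst c"
proof -
  note cD = is_chartD[OF c]
  obtain r where r: "r > 0" "cball (snd c p) r \<subseteq> snd c ` fst c"
    using cD(7) p open_contains_cball by blast
  let ?K = "chart_inv c ` cball (snd c p) r"
  have K: "closed ?K" "?K \<subseteq> fst c"
    using r cD(4,6) by (auto intro!: compact_imp_closed compact_continuous_image continuous_on_subset[OF cD(6)])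
  define b where "b q = (if q \<in> fst c then max 0 (r - dist (snd c q) (snd c p)) else 0)" for q
  have z: "b q = 0" if "q \<notin> ?K" for q
  proof (rule ccontr)
    assume "b q \<noteq> 0"
    then have "q \<in> fst c" "dist (snd c q) (snd c p) \<le> r" by (auto simp: b_def max_def split: if_splits)
    then have "chart_inv c (snd c q) \<in> ?K" by (simp add: dist_commute)
    then show False using that cD(2) \<open>q \<in> fst c\<close> by simp
  qed
  have "continuous_on (fst c) (\<lambda>q. max 0 (r - dist (snd c q) (snd c p)))"
    by (intro continuous_intros cD(5))
  then have "continuous_on (fst c) b" by (rule continuous_on_eq) (simp add: b_def)
  moreover have "continuous_on (- ?K) b"
    by (rule continuous_on_eq[OF continuous_on_const[of _ 0]]) (simp add: z)
  ultimately have "continuous_on (fst c \<union> - ?K) b"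
    using K(1) cD(1) by (intro continuous_on_open_Un) auto
  moreover have "fst c \<union> - ?K = UNIV" using K(2) by blast
  ultimately have "continuous_on UNIV b" by simp
  moreover have "closure {q. b q \<noteq> 0} \<subseteq> ?K"
    using z by (intro closure_minimal K) auto
  ultimately show ?thesis
    using that[of b] K(2) p r(1) by (auto simp: b_def)
qed

text \<open>\<open>surface_integral\<close> picks its partition with \<open>SOME\<close>, so nothing
  is known about the picked pair, not even that its charts lie in \<open>B\<close>, until some
  partition exists.\<close>

lemma partition_of_unity_exists:
  fixes S :: "('m::t2_space) set"
  assumes S: "compact S" "S \<subseteq> (\<Union>c\<in>B. fst c)" and B: "\<And>c. c \<in> B \<Longrightarrow> is_chart c"
  shows "\<exists>C \<rho>. partition_of_unity B S C \<rho>"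
proof -
  have "\<forall>p\<in>S. \<exists>c b. c \<in> B \<and> continuous_on UNIV b \<and> (\<forall>q. b q \<ge> (0::real)) \<and> b p > 0 \<and> closure {q. b q \<noteq> 0} \<subseteq> fst c"
  proof
    fix p assume "p \<in> S"
    then obtain c where c: "c \<in> B" "p \<in> fst c" using S by blast
    obtain b :: "'m \<Rightarrow> real" where "continuous_on UNIV b" "\<And>q. b q \<ge> 0" "b p > 0" "closure {q. b q \<noteq> 0} \<subseteq> fst c"
      using chart_bump[OF B[OF c(1)] c(2)] by metis
    then show "\<exists>c b. c \<in> B \<and> continuous_on UNIV b \<and> (\<forall>q. b q \<ge> (0::real)) \<and> b p > 0 \<and> closure {q. b q \<noteq> 0} \<subseteq> fst c"
      using c by blast
  qed
  then obtain \<gamma> b where \<gamma>b: "\<And>p. p \<in> S \<Longrightarrow> \<gamma> p \<in> B \<and> continuous_on UNIV (b p) \<and> (\<forall>q. b p q \<ge> (0::real)) \<and>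
      b p p > 0 \<and> closure {q. b p q \<noteq> 0} \<subseteq> fst (\<gamma> p)"
    by metis
  have "\<exists>F\<subseteq>S. finite F \<and> S \<subseteq> (\<Union>p\<in>F. {q. b p q > 0})"
  proof (rule compactE_image[OF S(1)])
    show "open {q. b p q > 0}" if "p \<in> S" for p
      using \<gamma>b[OF that] by (intro open_Collect_less continuous_on_const) auto
    show "S \<subseteq> (\<Union>p\<in>S. {q. b p q > 0})" using \<gamma>b by auto
  qed blast
  then obtain F where F: "F \<subseteq> S" "finite F" "S \<subseteq> (\<Union>p\<in>F. {q. b p q > 0})" by blast
  define t where "t q = (\<Sum>p\<in>F. b p q)" for q
  have t: "t q > 0" if "q \<in> S" for q
  proof -
    obtain p where "p \<in> F" "b p q > 0" using F(3) \<open>q \<in> S\<close> by blast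
    then show ?thesis unfolding t_def using F(1,2) \<gamma>b by (intro sum_pos2[of F p]) auto
  qed
  \<comment> \<open>A partition is indexed by charts, while the bumps are indexed by points, and
    several points may have been given the same chart; their bumps are added up.\<close>
  define \<rho> where "\<rho> c q = (\<Sum>p\<in>{p\<in>F. \<gamma> p = c}. b p q) / t q" for c q
  have "continuous_on S (\<rho> c) \<and> (\<forall>p\<in>S. \<rho> c p \<ge> 0) \<and> closure {p \<in> S. \<rho> c p \<noteq> 0} \<subseteq> fst c"
    if "c \<in> \<gamma> ` F" for c
  proof (intro conjI ballI)
    have cont: "continuous_on S (b p)" if "p \<in> F" for p
      using \<gamma>b F(1) that continuous_on_subset by blast
    show "continuous_on S (\<rho> c)"
      unfolding \<rho>_def t_def using t
      by (intro continuous_on_divide continuous_on_sum cont) (auto simp: t_def less_le)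
    show "\<rho> c p \<ge> 0" if "p \<in> S" for p
      unfolding \<rho>_def using t[OF that] \<gamma>b F(1) by (intro divide_nonneg_pos sum_nonneg) auto
    have "{p \<in> S. \<rho> c p \<noteq> 0} \<subseteq> (\<Union>p\<in>{p\<in>F. \<gamma> p = c}. closure {q. b p q \<noteq> 0})"
    proof
      fix q assume "q \<in> {p \<in> S. \<rho> c p \<noteq> 0}"
      then have "(\<Sum>p\<in>{p\<in>F. \<gamma> p = c}. b p q) \<noteq> 0" by (auto simp: \<rho>_def)
      then obtain p where "p \<in> {p\<in>F. \<gamma> p = c}" "b p q \<noteq> 0" by (meson sum.neutral)
      then show "q \<in> (\<Union>p\<in>{p\<in>F. \<gamma> p = c}. closure {q. b p q \<noteq> 0})"
        using closure_subset by fastforce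
    qed
    then have "closure {p \<in> S. \<rho> c p \<noteq> 0} \<subseteq> (\<Union>p\<in>{p\<in>F. \<gamma> p = c}. closure {q. b p q \<noteq> 0})"
      using F(2) by (intro closure_minimal closed_UN) auto
    also have "\<dots> \<subseteq> fst c" using \<gamma>b F(1) by blast
    finally show "closure {p \<in> S. \<rho> c p \<noteq> 0} \<subseteq> fst c" .
  qed
  moreover have "(\<Sum>c\<in>\<gamma> ` F. \<rho> c q) = 1" if "q \<in> S" for q
    using t[OF that] sum.image_gen[OF F(2), of "\<lambda>p. b p q" \<gamma>]
    by (simp add: \<rho>_def sum_divide_distrib[symmetric] t_def)
  moreover have "\<gamma> ` F \<subseteq> B" using F(1) \<gamma>b by blast
  ultimately have "partition_of_unity B S (\<gamma> ` F) \<rho>"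
    using F(2) unfolding partition_of_unity_def by blast
  then show ?thesis by blast
qed

lemma slice_chart_surface:
  assumes "slice_chart A S c" "u \<in> surf_dom c"
  shows "chart_inv c (slice2 u) \<in> S \<inter> fst c" "snd c (chart_inv c (slice2 u)) = slice2 u"
proof -
  have c: "is_chart c" using assms(1) by (auto simp: slice_chart_def oriented_charts_def)
  show *: "snd c (chart_inv c (slice2 u)) = slice2 u"
    using assms(2) is_chartD(3)[OF c] by (simp add: surf_dom_def)
  show "chart_inv c (slice2 u) \<in> S \<inter> fst c"
    using assms is_chartD(4)[OF c] * by (auto simp: surf_dom_def slice_chart_def slice2_def)
qed

text \<open>Both integrals unfold to the same partition picked by \<open>SOME\<close>. Its charts
  lie in \<open>B\<close>, and each parameter domain parametrizes points of S, where the integrands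
  agree.\<close>

lemma surface_integral_cong:
  fixes S :: "('m::t2_space) set"
  assumes S: "oriented_closed_surface A S B"
    and eq: "\<And>c p. c \<in> B \<Longrightarrow> p \<in> S \<inter> fst c \<Longrightarrow> \<Phi> c p = \<Psi> c p"
  shows "surface_integral B S \<Phi> = surface_integral B S \<Psi>"
proof -
  have sl: "slice_chart A S c" if "c \<in> B" for c
    using S that by (auto simp: oriented_closed_surface_def)
  have "is_chart c" if "c \<in> B" for c
    using sl[OF that] by (auto simp: slice_chart_def oriented_charts_def)
  then have "\<exists>C \<rho>. partition_of_unity B S C \<rho>"
    using S by (intro partition_of_unity_exists) (auto simp: oriented_closed_surface_def)
  then obtain C0 \<rho>0 where "case (C0, \<rho>0) of (C, \<rho>) \<Rightarrow> partition_of_unity B S C \<rho>" by auto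
  then have "case (SOME (C, \<rho>). partition_of_unity B S C \<rho>) of (C, \<rho>) \<Rightarrow> partition_of_unity B S C \<rho>"
    by (rule someI)
  then obtain C \<rho> where some: "(SOME (C, \<rho>). partition_of_unity B S C \<rho>) = (C, \<rho>)" "partition_of_unity B S C \<rho>"
    by (auto split: prod.splits)
  have "C \<subseteq> B" using some(2) by (simp add: partition_of_unity_def)
  then show ?thesis
    unfolding surface_integral_def some(1) Let_def prod.case
    using slice_chart_surface(1)[OF sl] eq
    by (intro sum.cong refl integral_cong) (auto simp: subset_iff)
qed

lemma surface_integral_mult_left:
  "surface_integral B S (\<lambda>c p. k * \<Phi> c p) = k * surface_integral B S \<Phi>"
  unfolding surface_integral_def
  by (simp add: split_beta Let_def sum_distrib_left mult.left_commute[of _ k] integral_mult_right)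

section \<open>Bilinear forms and their derivatives\<close>

lemma bilinear_bil: "bilinear (bil G)"
  by (auto simp: bilinear_def bil_def linear_iff matrix_vector_right_distrib inner_left_distrib
    inner_right_distrib scaleR_matrix_vector_assoc[symmetric] matrix_vector_mult_scaleR)

lemma bil_axis: "bil G (axis i 1) (axis j 1) = G $ i $ j"
  by (simp add: bil_def matrix_vector_mult_basis inner_axis' column_def)

lemma bil_sum: "bil G v w = (\<Sum>i\<in>UNIV. \<Sum>j\<in>UNIV. v $ i * w $ j * G $ i $ j)"
  using bilinear_expansion[OF bilinear_bil, of G v w] by (simp add: bil_axis)

lemma bil_diff: "bil (G - H) v w = bil G v w - bil H v w"
  by (simp add: bil_sum sum_subtractf algebra_simps)

lemma bil_commute:
  assumes "transpose G = G"
  shows "bil G v w = bil G w v"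
proof -
  have "G $ i $ j = G $ j $ i" for i j
    using arg_cong[OF assms, of "\<lambda>M. M $ j $ i"] by (simp add: transpose_def)
  then have "bil G w v = (\<Sum>i\<in>UNIV. \<Sum>j\<in>UNIV. w $ i * v $ j * G $ j $ i)"
    unfolding bil_sum by simp
  also have "\<dots> = bil G v w" unfolding bil_sum by (subst sum.swap) (simp add: mult_ac)
  finally show ?thesis by simp
qed

lemma bil_matrix_mult: "bil (transpose P ** G ** Q) v w = bil G (P *v v) (Q *v w)"
  by (simp add: bil_def matrix_vector_mul_assoc[symmetric] transpose_matrix_vector)
    (metis dot_lmul_matrix inner_commute)

lemma matrix_eqI_bil: "(\<And>v w. bil G v w = bil H v w) \<Longrightarrow> G = H"
  by (metis bil_axis vec_eq_iff)

lemma bil_matrix_of_form: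
  fixes q :: "real^'n \<Rightarrow> real^'n \<Rightarrow> real"
  assumes "bilinear q"
  shows "bil (\<chi> i j. q (axis i 1) (axis j 1)) v w = q v w"
  using bilinear_expansion[OF assms, of v w] by (simp add: bil_sum)

text \<open>Brings forms pulled back by a tangent map into the shape required by
  \<open>metric_trace_congruence\<close>.\<close>

lemma congruence_of_form:
  fixes q :: "real^'n \<Rightarrow> real^'n \<Rightarrow> real" and L :: "real^'n \<Rightarrow> real^'n"
  assumes "bilinear q" "linear L"
  shows "(\<chi> i j. q (L (axis i 1)) (L (axis j 1))) =
    transpose (matrix L) ** (\<chi> i j. q (axis i 1) (axis j 1)) ** matrix L"
proof -
  have b: "bilinear (\<lambda>v w. q (L v) (L w))"
    using assms by (auto simp: bilinear_def linear_iff)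
  show ?thesis
    by (rule matrix_eqI_bil)
      (simp add: bil_matrix_mult bil_matrix_of_form[OF assms(1)] bil_matrix_of_form[OF b]
        matrix_works linear_matrix_vector_mul_eq assms(2))
qed

lemma linear_bil_matrix: "linear (\<lambda>M. bil M v w)"
  by (auto simp: linear_iff bil_sum algebra_simps sum.distrib sum_distrib_left)

lemma bil_add_scaleR:
  "bil (A + B) v w = bil A v w + bil B v w" "bil (r *\<^sub>R A) v w = r * bil A v w"
  "bil A (v + v') w = bil A v w + bil A v' w" "bil A (r *\<^sub>R v) w = r * bil A v w"
  "bil A v (w + w') = bil A v w + bil A v w'" "bil A v (r *\<^sub>R w) = r * bil A v w"
  by (auto simp: bil_sum algebra_simps sum.distrib sum_distrib_left)

lemma fd_bil:
  assumes "G differentiable (at x)"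
  shows "fd (\<lambda>y. bil (G y) v w) x X = bil (fd G x X) v w"
  using fd_linear_compose[OF assms, of "\<lambda>M. bil M v w"] linear_bil_matrix linear_conv_bounded_linear by blast

lemma differentiable_matrixI:
  fixes G :: "'a::real_normed_vector \<Rightarrow> real^'n^'n"
  assumes "\<And>v w. (\<lambda>y. bil (G y) v w) differentiable (at x)"
  shows "G differentiable (at x)"
proof -
  have "G y = (\<Sum>i\<in>UNIV. \<Sum>j\<in>UNIV. bil (G y) (axis i 1) (axis j 1) *\<^sub>R axis i (axis j 1))" for y
  proof -
    have ax: "axis i (axis j 1 :: real^'n) $ k $ l = (if j = l then if i = k then 1 else 0 else 0)" for i j k l :: 'n
      by (simp add: axis_def)
    show ?thesis
      by (simp add: vec_eq_iff bil_axis ax if_distrib[where f = "\<lambda>x. _ * x"] cong: if_cong)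
  qed
  then have eq: "G = (\<lambda>y. \<Sum>i\<in>UNIV. \<Sum>j\<in>UNIV. bil (G y) (axis i 1) (axis j 1) *\<^sub>R axis i (axis j 1))"
    by blast
  show ?thesis
    by (subst eq) (intro differentiable_sum ballI differentiable_scaleR differentiable_const assms; simp)
qed

lemma differentiable_bil:
  assumes "G differentiable (at x)"
  shows "(\<lambda>y. bil (G y) v w) differentiable (at x)"
  unfolding bil_sum
  by (intro differentiable_sum ballI differentiable_mult differentiable_const differentiable_vec_nth assms) simp_all

lemma pd_entry:
  assumes "G differentiable (at x)"
  shows "pd (\<lambda>z. G z $ i $ j) m x = bil (fd G x (axis m 1)) (axis i 1) (axis j 1)"
  by (simp add: pd_def bil_axis fd_vec_nth assms differentiable_vec_nth)

lemma bil_pullback_metric: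
  assumes "f differentiable (at y)"
  shows "bil (pullback_metric G f y) v w = bil (G (f y)) (fd f y v) (fd f y w)"
proof -
  have "bilinear (\<lambda>v w. bil (G (f y)) (fd f y v) (fd f y w))"
    using bilinear_bil[of "G (f y)"] linear_fd[OF assms] by (auto simp: bilinear_def linear_iff)
  from bil_matrix_of_form[OF this] show ?thesis
    by (simp add: pullback_metric_def pd_def)
qed

text \<open>Lowering the upper index cancels the inverse metric in \<open>christoffel\<close>. What
  remains is the Koszul formula for constant coordinate fields.\<close>

lemma bil_christoffel:
  fixes G :: "real^'n \<Rightarrow> real^'n^'n"
  assumes G: "G differentiable (at y)" "det (G y) \<noteq> 0" "transpose (G y) = G y"
  shows "bil (G y) (\<chi> i. \<Sum>j\<in>UNIV. \<Sum>k\<in>UNIV. christoffel G i j k y * v $ j * w $ k) n =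
    1/2 * (bil (fd G y v) n w + bil (fd G y w) n v - bil (fd G y n) v w)"
proof -
  define T where "T v w n = bil (fd G y v) n w + bil (fd G y w) n v - bil (fd G y n) v w" for v w n
  note lin = linear_fd[OF G(1)]
  have T12: "bilinear (\<lambda>v w. T v w n)" for n
    using lin by (auto simp: bilinear_def linear_iff T_def bil_add_scaleR algebra_simps)
  have T3: "linear (T v w)" for v w
    using lin by (auto simp: linear_iff T_def bil_add_scaleR algebra_simps)
  let ?t = "\<chi> d. T v w (axis d 1)"
  have chr: "christoffel G i j k y = 1/2 * (\<Sum>d\<in>UNIV. matrix_inv (G y) $ i $ d * T (axis j 1) (axis k 1) (axis d 1))" for i j k
    unfolding christoffel_def T_def pd_entry[OF G(1)] ..
  have "(\<Sum>j\<in>UNIV. \<Sum>k\<in>UNIV. christoffel G i j k y * v $ j * w $ k) = ((1/2) *\<^sub>R (matrix_inv (G y) *v ?t)) $ i" for i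
  proof -
    have "(\<Sum>j\<in>UNIV. \<Sum>k\<in>UNIV. christoffel G i j k y * v $ j * w $ k) =
      (\<Sum>j\<in>UNIV. \<Sum>k\<in>UNIV. \<Sum>d\<in>UNIV. 1/2 * (matrix_inv (G y) $ i $ d * (v $ j * w $ k * T (axis j 1) (axis k 1) (axis d 1))))"
      by (simp add: chr sum_distrib_left sum_distrib_right mult_ac)
    also have "\<dots> = (\<Sum>j\<in>UNIV. \<Sum>d\<in>UNIV. \<Sum>k\<in>UNIV. 1/2 * (matrix_inv (G y) $ i $ d * (v $ j * w $ k * T (axis j 1) (axis k 1) (axis d 1))))"
      by (rule sum.cong[OF refl], rule sum.swap)
    also have "\<dots> = (\<Sum>d\<in>UNIV. \<Sum>j\<in>UNIV. \<Sum>k\<in>UNIV. 1/2 * (matrix_inv (G y) $ i $ d * (v $ j * w $ k * T (axis j 1) (axis k 1) (axis d 1))))"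
      by (rule sum.swap)
    also have "\<dots> = (\<Sum>d\<in>UNIV. 1/2 * (matrix_inv (G y) $ i $ d * T v w (axis d 1)))"
      unfolding sum_distrib_left[symmetric] bilinear_expansion[OF T12, of v w, symmetric] ..
    finally show ?thesis by (simp add: matrix_vector_mult_def sum_divide_distrib)
  qed
  then have "(\<chi> i. \<Sum>j\<in>UNIV. \<Sum>k\<in>UNIV. christoffel G i j k y * v $ j * w $ k) = (1/2) *\<^sub>R (matrix_inv (G y) *v ?t)"
    by (simp add: vec_eq_iff)
  then have "bil (G y) (\<chi> i. \<Sum>j\<in>UNIV. \<Sum>k\<in>UNIV. christoffel G i j k y * v $ j * w $ k) n =
    bil (G y) n ((1/2) *\<^sub>R (matrix_inv (G y) *v ?t))"
    using bil_commute[OF G(3)] by simp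
  also have "\<dots> = 1/2 * (n \<bullet> ((G y ** matrix_inv (G y)) *v ?t))"
    by (simp add: bil_def matrix_vector_mult_scaleR matrix_vector_mul_assoc)
  also have "\<dots> = 1/2 * T v w n"
    unfolding matrix_inv_cancel(1)[OF G(2)] linear_axis_expansion[OF T3, of v w n]
    by (simp add: inner_vec_def)
  finally show ?thesis by (simp add: T_def)
qed

lemma pd_const [simp]: "pd (\<lambda>_. a) i x = 0"
  by (simp add: pd_def fd_eq[OF has_derivative_const])

lemma second_fundamental_form_euclidean:
  "second_fundamental_form (\<lambda>_. mat 1) f u n $ A $ B = - (n \<bullet> pd (pd f B) A u)"
  by (simp add: second_fundamental_form_def christoffel_def bil_def inner_commute)

section \<open>Slices\<close>

lemma bounded_linear_slice2: "bounded_linear slice2"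
  unfolding linear_conv_bounded_linear[symmetric]
  by (auto simp: linear_iff slice2_def vec_eq_iff)

lemma bounded_linear_slice3: "bounded_linear slice3"
  unfolding linear_conv_bounded_linear[symmetric]
  by (auto simp: linear_iff slice3_def vec_eq_iff)

lemma bounded_linear_spatial: "bounded_linear spatial"
  unfolding linear_conv_bounded_linear[symmetric]
  by (auto simp: linear_iff spatial_def vec_eq_iff forall_3)

abbreviation emb2 :: "real^2 \<Rightarrow> real^3" where
  "emb2 \<equiv> (\<lambda>u. vector [0, u$1, u$2])"

lemma bounded_linear_emb2: "bounded_linear emb2"
  unfolding linear_conv_bounded_linear[symmetric]
  by (auto simp: linear_iff vec_eq_iff forall_3)

lemma slice3_emb2: "slice3 (vector [0, u$1, u$2]) = slice2 u"
  by (simp add: slice3_def slice2_def vec_eq_iff all_4)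

lemma spatial_slice3: "spatial (slice3 v) = v"
  by (simp add: spatial_def slice3_def vec_eq_iff forall_3)

lemma fd_bounded_linear: "bounded_linear L \<Longrightarrow> fd L x = L"
  by (intro fd_eq bounded_linear_imp_has_derivative)

lemma fd_compose_linear:
  assumes "bounded_linear L" "f differentiable (at (L x))"
  shows "fd (\<lambda>x. f (L x)) x v = fd f (L x) (L v)"
  using fd_compose[OF bounded_linear_imp_differentiable[OF assms(1)] assms(2)] fd_bounded_linear[OF assms(1)] by simp

lemma open_slice2_vimage: "open V \<Longrightarrow> open {u. slice2 u \<in> V}"
  using open_vimage[of V slice2] linear_continuous_on[OF bounded_linear_slice2, of UNIV]
  by (simp add: vimage_def)

lemma bil_minkowski: "bil minkowski v w = spatial v \<bullet> spatial w - v $ 0 * w $ 0"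
  by (simp add: bil_sum sum_UNIV_4 minkowski_def inner_vec_def sum_3 spatial_def)

text \<open>Since \<open>slice3\<close> is linear, inducing the metric on the hypersurface commutes
  with differentiating it: no second derivatives of the parametrization appear.\<close>

lemma pullback_slice3:
  fixes G :: "real^4 \<Rightarrow> real^4^4"
  assumes "G differentiable (at (slice3 x))"
  shows "bil (pullback_metric G slice3 x) v w = bil (G (slice3 x)) (slice3 v) (slice3 w)"
    "pullback_metric G slice3 differentiable (at x)"
    "bil (fd (pullback_metric G slice3) x X) v w = bil (fd G (slice3 x) (slice3 X)) (slice3 v) (slice3 w)"
proof -
  have b: "bil (pullback_metric G slice3 y) v w = bil (G (slice3 y)) (slice3 v) (slice3 w)" for v w y
    using bil_pullback_metric[OF bounded_linear_imp_differentiable[OF bounded_linear_slice3]]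
    by (simp add: fd_bounded_linear[OF bounded_linear_slice3])
  then show "bil (pullback_metric G slice3 x) v w = bil (G (slice3 x)) (slice3 v) (slice3 w)" .
  have "(\<lambda>y. bil (G (slice3 y)) v w) differentiable (at x)" for v w
    using differentiable_chain_at[OF bounded_linear_imp_differentiable[OF bounded_linear_slice3] differentiable_bil[OF assms]]
    by (simp add: o_def)
  then show *: "pullback_metric G slice3 differentiable (at x)"
    by (intro differentiable_matrixI) (simp add: b)
  show "bil (fd (pullback_metric G slice3) x X) v w = bil (fd G (slice3 x) (slice3 X)) (slice3 v) (slice3 w)"
    unfolding fd_bil[OF *, symmetric] fd_bil[OF assms, symmetric] b
    by (rule fd_compose_linear[OF bounded_linear_slice3 differentiable_bil[OF assms]])
qed

text \<open>In boundary coordinates S is a coordinate plane, so the second derivative of its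
  parametrization is zero and the Koszul formula supplies everything.\<close>

lemma second_fundamental_form_domain:
  fixes G :: "real^4 \<Rightarrow> real^4^4"
  assumes G: "G differentiable (at (slice2 u))" "transpose (G (slice2 u)) = G (slice2 u)"
    and det: "det (pullback_metric G slice3 (emb2 u)) \<noteq> 0"
  shows "second_fundamental_form (pullback_metric G slice3) emb2 u n $ A $ B =
    - 1/2 * (bil (fd G (slice2 u) (slice2 (axis A 1))) (slice3 n) (slice2 (axis B 1))
      + bil (fd G (slice2 u) (slice2 (axis B 1))) (slice3 n) (slice2 (axis A 1))
      - bil (fd G (slice2 u) (slice3 n)) (slice2 (axis A 1)) (slice2 (axis B 1)))"
proof -
  let ?H = "pullback_metric G slice3"
  have G': "G differentiable (at (slice3 (emb2 u)))" using G(1) by (simp add: slice3_emb2)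
  note H = pullback_slice3[OF G']
  have pd: "pd emb2 B = (\<lambda>_. emb2 (axis B 1))" for B
    by (simp add: pd_def fun_eq_iff fd_bounded_linear[OF bounded_linear_emb2])
  have "transpose (?H (emb2 u)) = ?H (emb2 u)"
  proof (rule matrix_eqI_bil)
    fix v w
    have "bil (transpose (?H (emb2 u))) v w = bil (?H (emb2 u)) w v"
      by (simp add: bil_sum transpose_def) (subst sum.swap, simp add: mult_ac)
    then show "bil (transpose (?H (emb2 u))) v w = bil (?H (emb2 u)) v w"
      using bil_commute[OF G(2)] by (simp add: H(1) slice3_emb2)
  qed
  from bil_christoffel[OF H(2) det this] show ?thesis
    by (simp add: second_fundamental_form_def pd H(3) slice3_emb2)
qed

section \<open>Two charts at a point of the surface\<close>

abbreviation minkowski_pullback :: "(real^4 \<Rightarrow> real^4) \<Rightarrow> real^4 \<Rightarrow> real^4^4" where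
  "minkowski_pullback F \<equiv> pullback_metric (\<lambda>_. minkowski) F"

lemma transpose_minkowski: "transpose minkowski = minkowski"
  by (auto simp: transpose_def minkowski_def vec_eq_iff)

lemma minkowski_pullback_derivative:
  assumes V: "open V" "y \<in> V" and F: "twice_differentiable_on V F"
  shows "minkowski_pullback F differentiable (at y)"
    and "bil (fd (minkowski_pullback F) y X) v w =
      bil minkowski (fd (\<lambda>z. fd F z v) y X) (fd F y w) + bil minkowski (fd F y v) (fd (\<lambda>z. fd F z w) y X)"
proof -
  note dF = twice_differentiable_onD[OF F]
  have eq: "bil (minkowski_pullback F z) v w = bil minkowski (fd F z v) (fd F z w)" if "z \<in> V" for z v w
    using bil_pullback_metric[OF dF(1)[OF that]] .
  have bb: "bounded_bilinear (bil minkowski)"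
    using bilinear_bil bilinear_conv_bounded_bilinear by blast
  have der: "((\<lambda>z. bil minkowski (fd F z v) (fd F z w)) has_derivative
    (\<lambda>X. bil minkowski (fd F y v) (fd (\<lambda>z. fd F z w) y X) + bil minkowski (fd (\<lambda>z. fd F z v) y X) (fd F y w))) (at y)" for v w
    by (rule bounded_bilinear.FDERIV[OF bb has_derivative_fd[OF dF(2)[OF V(2)]] has_derivative_fd[OF dF(2)[OF V(2)]]])
  then have der': "((\<lambda>z. bil (minkowski_pullback F z) v w) has_derivative
    (\<lambda>X. bil minkowski (fd F y v) (fd (\<lambda>z. fd F z w) y X) + bil minkowski (fd (\<lambda>z. fd F z v) y X) (fd F y w))) (at y)" for v w
    using has_derivative_cong_open[OF V eq] by simp
  show *: "minkowski_pullback F differentiable (at y)"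
    by (rule differentiable_matrixI) (use der' in \<open>auto simp: differentiable_def\<close>)
  show "bil (fd (minkowski_pullback F) y X) v w =
      bil minkowski (fd (\<lambda>z. fd F z v) y X) (fd F y w) + bil minkowski (fd F y v) (fd (\<lambda>z. fd F z w) y X)"
    using fd_bil[OF *, of v w X] fd_eq[OF der', of v w] by simp
qed

text \<open>The first-kind Christoffel symbols of a flat metric are the inner products of the second
  derivatives of a flat coordinate system with its first derivatives.\<close>

lemma minkowski_pullback_christoffel:
  assumes V: "open V" "y \<in> V" and F: "twice_differentiable_on V F"
  defines "B \<equiv> minkowski_pullback F"
  shows "bil (fd B y v) n w + bil (fd B y w) n v - bil (fd B y n) v w =
    2 * bil minkowski (fd (\<lambda>z. fd F z v) y w) (fd F y n)"
  unfolding B_def minkowski_pullback_derivative(2)[OF V F]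
  using second_derivative_symmetric[OF V F, of v n] second_derivative_symmetric[OF V F, of w n]
    second_derivative_symmetric[OF V F, of v w] bil_commute[OF transpose_minkowski] by (simp add: algebra_simps)

lemma slice2_eqI: "y $ 0 = 0 \<Longrightarrow> y $ 1 = 0 \<Longrightarrow> slice2 (vector [y $ 2, y $ 3]) = y"
  by (simp add: slice2_def vec_eq_iff all_4)

lemma bounded_linear_proj23: "bounded_linear (\<lambda>y::real^4. vector [y $ 2, y $ 3] :: real^2)"
  unfolding linear_conv_bounded_linear[symmetric]
  by (auto simp: linear_iff vec_eq_iff forall_2)

text \<open>The matrix with rows \<open>pd f 1 u\<close>, \<open>pd f 2 u\<close> and
  \<open>n\<close> has Gram determinant equal to that of the first fundamental form, hence is
  invertible. A second candidate is thus a multiple of \<open>n\<close>, and of the two unit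
  multiples the negative one would put points of the normal line both inside and outside.\<close>

lemma euclidean_outward_normal_eq:
  assumes n: "norm n = 1" "\<And>A. n \<bullet> pd f A u = 0" "points_outward \<Sigma> (f u) n"
    and det: "det (pullback_metric (\<lambda>_. mat 1) f u) \<noteq> 0"
  shows "euclidean_outward_normal \<Sigma> f u = n"
  unfolding euclidean_outward_normal_def
proof (rule the_equality)
  fix m assume m: "norm m = 1 \<and> (\<forall>A. m \<bullet> pd f A u = 0) \<and> points_outward \<Sigma> (f u) m"
  have nn: "n \<bullet> n = 1" using n(1) by (simp add: norm_eq_1)
  let ?M = "vector [pd f 1 u, pd f 2 u, n] :: real^3^3"
  have entry: "(?M ** transpose ?M) $ i $ j = ?M $ i \<bullet> ?M $ j" for i j
    by (simp add: matrix_matrix_mult_def transpose_def inner_vec_def)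
  have "det (?M ** transpose ?M) = det (pullback_metric (\<lambda>_. mat 1) f u)"
    using n(2) nn by (simp add: det_3 det_2 entry pullback_metric_def bil_def inner_commute)
  then have "det ?M \<noteq> 0" using det by (auto simp: det_mul)
  then have inj: "x = 0" if "?M *v x = 0" for x
    using that matrix_inv_cancel(2)[of ?M] by (metis matrix_vector_mul_assoc matrix_vector_mul_lid matrix_vector_mult_0_right)
  have "?M *v (m - (m \<bullet> n) *\<^sub>R n) = 0"
    using m n(2) nn
    by (simp add: vec_eq_iff forall_3 matrix_vector_mul_component inner_diff_right inner_commute)
  then have mn: "m = (m \<bullet> n) *\<^sub>R n" using inj by fastforce
  then have "\<bar>m \<bullet> n\<bar> = 1" using m n(1) by (metis mult.right_neutral norm_scaleR)
  moreover have "m \<bullet> n \<noteq> -1"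
  proof
    assume "m \<bullet> n = -1"
    then have m_eq: "m = - n" using mn by simp
    obtain e1 where e1: "e1 > 0" "\<And>t. 0 < t \<Longrightarrow> t < e1 \<Longrightarrow> f u + t *\<^sub>R n \<in> outside \<Sigma>"
      using n(3) unfolding points_outward_def by blast
    obtain e2 where e2: "e2 > 0" "\<And>t. 0 < t \<Longrightarrow> t < e2 \<Longrightarrow> f u - t *\<^sub>R m \<in> inside \<Sigma>"
      using m unfolding points_outward_def by blast
    define t where "t = min e1 e2 / 2"
    have "0 < t" "t < e1" "t < e2" using e1(1) e2(1) by (auto simp: t_def)
    then have "f u + t *\<^sub>R n \<in> inside \<Sigma> \<inter> outside \<Sigma>" using e1(2)[of t] e2(2)[of t] by (intro IntI) (simp_all add: m_eq)
    then show False using inside_Int_outside[of \<Sigma>] by blast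
  qed
  ultimately have "m \<bullet> n = 1" by linarith
  then show "m = n" using mn by simp
qed (use n in auto)

text \<open>The data at a point of the surface in two slice charts \<open>c\<close> and \<open>d\<close> with transition map \<open>\<kappa>\<close>:
  the metrics \<open>Gc\<close>, \<open>Gd\<close> and the reference \<open>Fc\<close>, \<open>Fd\<close> in these charts, and the pullback \<open>Bc\<close> of
  the Minkowski metric.\<close>

locale matched_charts =
  fixes Vc Vd :: "(real^4) set" and \<kappa> Fc Fd :: "real^4 \<Rightarrow> real^4" and Gc Gd Bc :: "real^4 \<Rightarrow> real^4^4"
    and uc ud :: "real^2" and t :: real
  assumes open_Vc: "open Vc" and open_Vd: "open Vd"
    and \<kappa>_image: "\<kappa> ` Vc \<subseteq> Vd" and \<kappa>_diff: "twice_differentiable_on Vc \<kappa>"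
    and Fd_diff: "twice_differentiable_on Vd Fd" and Fc_eq: "\<And>y. y \<in> Vc \<Longrightarrow> Fc y = Fd (\<kappa> y)"
    and Gd_diff: "Gd differentiable (at (slice2 ud))" and Gc_diff: "Gc differentiable (at (slice2 uc))"
    and Gd_sym: "\<And>y. y \<in> Vd \<Longrightarrow> transpose (Gd y) = Gd y"
    and Gc_eq: "\<And>y v w. y \<in> Vc \<Longrightarrow> bil (Gc y) v w = bil (Gd (\<kappa> y)) (fd \<kappa> y v) (fd \<kappa> y w)"
    and Bc_eq: "\<And>y. y \<in> Vc \<Longrightarrow> Bc y = minkowski_pullback Fc y"
    and uc: "slice2 uc \<in> Vc" "\<kappa> (slice2 uc) = slice2 ud"
    and \<kappa>_surface: "\<And>u. slice2 u \<in> Vc \<Longrightarrow> \<kappa> (slice2 u) $ 0 = 0" "\<And>u. slice2 u \<in> Vc \<Longrightarrow> \<kappa> (slice2 u) $ 1 = 0"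
    and matching: "\<And>u. slice2 u \<in> Vd \<Longrightarrow> Gd (slice2 u) = minkowski_pullback Fd (slice2 u)"
    and time_const: "\<And>u. slice2 u \<in> Vd \<Longrightarrow> Fd (slice2 u) $ 0 = t"
begin

abbreviation "yc \<equiv> slice2 uc"
abbreviation "yd \<equiv> slice2 ud"
abbreviation "J \<equiv> fd \<kappa> yc"
abbreviation "Bd \<equiv> minkowski_pullback Fd"
abbreviation "Ed \<equiv> (\<lambda>y. Gd y - Bd y)"
abbreviation "Ec \<equiv> (\<lambda>y. Gc y - Bc y)"
abbreviation "Wc \<equiv> {u. slice2 u \<in> Vc}"
abbreviation "Wd \<equiv> {u. slice2 u \<in> Vd}"

section \<open>The transition map restricted to the surface\<close>

definition "\<kappa>2 u = (vector [\<kappa> (slice2 u) $ 2, \<kappa> (slice2 u) $ 3] :: real^2)"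

abbreviation "K \<equiv> fd \<kappa>2 uc"

lemma yd: "yd \<in> Vd" using uc \<kappa>_image by (metis image_subset_iff)

lemma open_Wc: "open Wc" and open_Wd: "open Wd" and uc_Wc: "uc \<in> Wc" and ud_Wd: "ud \<in> Wd"
  using open_Vc open_Vd uc yd by (auto intro: open_slice2_vimage)

lemma \<kappa>2: "u \<in> Wc \<Longrightarrow> slice2 (\<kappa>2 u) = \<kappa> (slice2 u)"
  unfolding \<kappa>2_def using \<kappa>_surface by (intro slice2_eqI) auto

lemma \<kappa>2_Wd: "\<kappa>2 ` Wc \<subseteq> Wd"
  using \<kappa>2 \<kappa>_image by auto

lemma \<kappa>2_uc: "\<kappa>2 uc = ud"
  using uc by (simp add: \<kappa>2_def) (simp add: slice2_def vec_eq_iff forall_2)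

lemma \<kappa>2_diff: "twice_differentiable_on Wc \<kappa>2"
proof -
  have "twice_differentiable_on Wc (\<lambda>u. \<kappa> (slice2 u))"
    by (rule twice_differentiable_on_compose[OF open_Wc twice_differentiable_on_linear[OF bounded_linear_slice2] \<kappa>_diff]) auto
  then show ?thesis
    using twice_differentiable_on_compose[OF open_Wc _ twice_differentiable_on_linear[OF bounded_linear_proj23, of UNIV]]
    unfolding \<kappa>2_def[abs_def] by simp
qed

text \<open>The transition map carries S to S, so its derivative respects tangent vectors and acts
  on them as the Jacobian \<open>K\<close> of the surface coordinates.\<close>

lemma J_slice2: "J (slice2 v) = slice2 (K v)"
proof -
  have "slice2 (K v) = fd (\<lambda>u. slice2 (\<kappa>2 u)) uc v"
    using fd_linear_compose[OF twice_differentiable_onD(1)[OF \<kappa>2_diff uc_Wc] bounded_linear_slice2] by simp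
  also have "\<dots> = fd (\<lambda>u. \<kappa> (slice2 u)) uc v"
    using fd_cong_open[OF open_Wc uc_Wc \<kappa>2] by simp
  also have "\<dots> = J (slice2 v)"
    using fd_compose_linear[OF bounded_linear_slice2 twice_differentiable_onD(1)[OF \<kappa>_diff uc(1)]] by simp
  finally show ?thesis by simp
qed

lemma linear_K: "linear K"
  by (rule linear_fd[OF twice_differentiable_onD(1)[OF \<kappa>2_diff uc_Wc]])

lemma fd_Fc: "y \<in> Vc \<Longrightarrow> fd Fc y v = fd Fd (\<kappa> y) (fd \<kappa> y v)"
proof -
  assume y: "y \<in> Vc"
  have "\<kappa> y \<in> Vd" using y \<kappa>_image by blast
  from fd_compose[OF twice_differentiable_onD(1)[OF \<kappa>_diff y] twice_differentiable_onD(1)[OF Fd_diff this]]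
  show ?thesis using fd_cong_open[OF open_Vc y Fc_eq] by simp
qed

lemma Fc_diff: "twice_differentiable_on Vc Fc"
  by (rule twice_differentiable_on_cong[OF open_Vc _ twice_differentiable_on_compose[OF open_Vc \<kappa>_diff Fd_diff \<kappa>_image]])
    (simp add: Fc_eq)

lemma bil_Bc: "y \<in> Vc \<Longrightarrow> bil (Bc y) v w = bil (Bd (\<kappa> y)) (fd \<kappa> y v) (fd \<kappa> y w)"
proof -
  assume y: "y \<in> Vc"
  have \<kappa>y: "\<kappa> y \<in> Vd" using y \<kappa>_image by blast
  show ?thesis
    using bil_pullback_metric[OF twice_differentiable_onD(1)[OF Fc_diff y]]
      bil_pullback_metric[OF twice_differentiable_onD(1)[OF Fd_diff \<kappa>y]]
    by (simp add: Bc_eq[OF y] fd_Fc[OF y])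
qed

lemma Bc_diff: "Bc differentiable (at yc)"
  using minkowski_pullback_derivative(1)[OF open_Vc uc(1) Fc_diff]
    differentiable_cong_open[OF open_Vc uc(1) Bc_eq] by simp

section \<open>First derivatives of the difference of the two metrics\<close>

lemma Ed_diff: "Ed differentiable (at yd)"
  by (intro differentiable_diff Gd_diff minkowski_pullback_derivative(1)[OF open_Vd yd Fd_diff])

lemma fd_Ed: "fd Ed yd X = fd Gd yd X - fd Bd yd X"
proof -
  note G = has_derivative_fd[OF Gd_diff]
    and B = has_derivative_fd[OF minkowski_pullback_derivative(1)[OF open_Vd yd Fd_diff]]
  show ?thesis using fd_eq[OF has_derivative_diff[OF G B]] by simp
qed

lemma fd_Ec: "fd Ec yc X = fd Gc yc X - fd Bc yc X"
  using fd_eq[OF has_derivative_diff[OF has_derivative_fd[OF Gc_diff] has_derivative_fd[OF Bc_diff]]] by simp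

lemma fd_Ed_tangent: "fd Ed yd (slice2 v) = 0"
proof -
  have "fd Ed yd (slice2 v) = fd (\<lambda>u. Ed (slice2 u)) ud v"
    using fd_compose_linear[OF bounded_linear_slice2 Ed_diff] by simp
  also have "\<dots> = fd (\<lambda>_. 0 :: real^4^4) ud v"
    using fd_cong_open[OF open_Wd ud_Wd, of "\<lambda>u. Ed (slice2 u)" "\<lambda>_. 0"] matching by simp
  also have "\<dots> = 0" by (simp add: fd_eq[OF has_derivative_const])
  finally show ?thesis .
qed

text \<open>As \<open>Gd - Bd\<close> vanishes on the surface, its first derivatives transform as a tensor.\<close>

lemma fd_Ec_tensor: "bil (fd Ec yc X) v w = bil (fd Ed yd (J X)) (J v) (J w)"
proof -
  note d\<kappa> = twice_differentiable_onD[OF \<kappa>_diff uc(1)]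
  have Ec: "bil (Ec y) v w = (\<Sum>i\<in>UNIV. \<Sum>j\<in>UNIV. fd \<kappa> y v $ i * fd \<kappa> y w $ j * Ed (\<kappa> y) $ i $ j)" if "y \<in> Vc" for y
    unfolding bil_sum[symmetric] by (simp only: bil_diff Gc_eq[OF that] bil_Bc[OF that])
  have "((\<lambda>y. \<Sum>i\<in>UNIV. \<Sum>j\<in>UNIV. fd \<kappa> y v $ i * fd \<kappa> y w $ j * Ed (\<kappa> y) $ i $ j) has_derivative
    (\<lambda>X. \<Sum>i\<in>UNIV. \<Sum>j\<in>UNIV. J v $ i * J w $ j * fd Ed yd (J X) $ i $ j)) (at yc)"
  proof (intro has_derivative_sum)
    fix i j :: 4
    have Ed: "Ed differentiable (at (\<kappa> yc))" using Ed_diff uc(2) by simp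
    have "((\<lambda>y. Ed (\<kappa> y)) has_derivative (\<lambda>X. fd Ed yd (J X))) (at yc)"
      using diff_chain_at[OF has_derivative_fd[OF d\<kappa>(1)] has_derivative_fd[OF Ed]] uc(2) by (simp add: o_def)
    then have 1: "((\<lambda>y. Ed (\<kappa> y) $ i $ j) has_derivative (\<lambda>X. fd Ed yd (J X) $ i $ j)) (at yc)"
      by (intro bounded_linear.has_derivative[OF bounded_linear_vec_nth])
    have 2: "(\<lambda>y. fd \<kappa> y v $ i * fd \<kappa> y w $ j) differentiable (at yc)"
      by (intro differentiable_mult differentiable_vec_nth d\<kappa>)
    \<comment> \<open>The product rule also differentiates the Jacobian factors, but that term is
      multiplied by the value of \<open>Ed\<close> on the surface, which is zero.\<close>
    show "((\<lambda>y. fd \<kappa> y v $ i * fd \<kappa> y w $ j * Ed (\<kappa> y) $ i $ j) has_derivative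
      (\<lambda>X. J v $ i * J w $ j * fd Ed yd (J X) $ i $ j)) (at yc)"
      using has_derivative_mult[OF has_derivative_fd[OF 2] 1] matching yd by (simp add: uc(2))
  qed
  note der = fd_eq[OF this]
  have "Ec differentiable (at yc)" by (intro differentiable_diff Gc_diff Bc_diff)
  then have "bil (fd Ec yc X) v w = fd (\<lambda>y. bil (Ec y) v w) yc X" by (rule fd_bil[symmetric])
  also have "\<dots> = fd (\<lambda>y. \<Sum>i\<in>UNIV. \<Sum>j\<in>UNIV. fd \<kappa> y v $ i * fd \<kappa> y w $ j * Ed (\<kappa> y) $ i $ j) yc X"
    by (rule fun_cong[OF fd_cong_open[OF open_Vc uc(1)]]) (rule Ec)
  also have "\<dots> = bil (fd Ed yd (J X)) (J v) (J w)"
    unfolding der bil_sum ..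
  finally show ?thesis .
qed

lemma fd_Ed_symmetric: "bil (fd Ed yd X) v w = bil (fd Ed yd X) w v"
proof -
  have "bil (Ed y) v w = bil (Ed y) w v" if "y \<in> Vd" for y
    unfolding bil_diff bil_pullback_metric[OF twice_differentiable_onD(1)[OF Fd_diff that]]
    using bil_commute[OF transpose_minkowski] bil_commute[OF Gd_sym[OF that]] by simp
  then show ?thesis
    unfolding fd_bil[OF Ed_diff, symmetric] by (intro fun_cong[OF fd_cong_open[OF open_Vd yd]])
qed

lemma fd_Fd_time: "fd Fd yd (slice2 v) $ 0 = 0"
proof -
  note dF = twice_differentiable_onD(1)[OF Fd_diff yd]
  have "fd Fd yd (slice2 v) $ 0 = fd (\<lambda>u. Fd (slice2 u) $ 0) ud v"
    using fd_compose_linear[OF bounded_linear_slice2 differentiable_vec_nth[OF dF], of 0 v] fd_vec_nth[OF dF, of 0 "slice2 v"]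
    by simp
  also have "\<dots> = fd (\<lambda>_. t) ud v"
    using fd_cong_open[OF open_Wd ud_Wd, of "\<lambda>u. Fd (slice2 u) $ 0" "\<lambda>_. t"] time_const by simp
  also have "\<dots> = 0" by (simp add: fd_eq[OF has_derivative_const])
  finally show ?thesis .
qed

lemma Gc_Bc: "Gc yc = Bc yc"
  by (rule matrix_eqI_bil) (simp add: Gc_eq[OF uc(1)] bil_Bc[OF uc(1)] uc(2) matching yd)

section \<open>The image of the surface in Euclidean space\<close>

abbreviation "fc \<equiv> spatial \<circ> Fc \<circ> slice2"

lemma fc_diff: "twice_differentiable_on Wc fc"
proof -
  have "twice_differentiable_on Wc (\<lambda>u. Fc (slice2 u))"
    by (rule twice_differentiable_on_compose[OF open_Wc twice_differentiable_on_linear[OF bounded_linear_slice2] Fc_diff]) auto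
  from twice_differentiable_on_compose[OF open_Wc this twice_differentiable_on_linear[OF bounded_linear_spatial, of UNIV]]
  show ?thesis by (simp add: o_def)
qed

lemma fd_fc: "u \<in> Wc \<Longrightarrow> fd fc u v = spatial (fd Fc (slice2 u) (slice2 v))"
proof -
  assume u: "u \<in> Wc"
  have F: "Fc differentiable (at (slice2 u))" using twice_differentiable_onD(1)[OF Fc_diff] u by simp
  have "(\<lambda>y. spatial (Fc y)) differentiable (at (slice2 u))"
    using differentiable_chain_at[OF F bounded_linear_imp_differentiable[OF bounded_linear_spatial]] by (simp add: o_def)
  from fd_compose_linear[OF bounded_linear_slice2 this] show ?thesis
    using fd_linear_compose[OF F bounded_linear_spatial] by (simp add: o_def)
qed

text \<open>The time component of the reference is constant along S, so on tangent vectors the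
  Minkowski product is the Euclidean one. Hence the spatial part of the reference is an isometric
  embedding of S.\<close>

lemma fc_first_fundamental_form:
  "pullback_metric (\<lambda>_. mat 1) fc uc = (\<chi> A B. bil (Gd yd) (slice2 (K (axis A 1))) (slice2 (K (axis B 1))))"
proof -
  have "bil (Gd yd) (slice2 v) (slice2 w) = spatial (fd Fd yd (slice2 v)) \<bullet> spatial (fd Fd yd (slice2 w))" for v w
    using matching[of ud] yd bil_pullback_metric[OF twice_differentiable_onD(1)[OF Fd_diff yd]]
    by (simp add: bil_minkowski fd_Fd_time)
  moreover have "fd fc uc v = spatial (fd Fd yd (slice2 (K v)))" for v
    using fd_fc[OF uc_Wc] fd_Fc[OF uc(1)] by (simp add: uc(2) J_slice2)
  ultimately show ?thesis
    by (simp add: pullback_metric_def pd_def) (simp add: bil_def)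
qed

text \<open>Up to sign, the second fundamental form is the Hessian of the height in the normal
  direction. The height is critical at the point, so its Hessian passes from the coordinates of
  \<open>c\<close> to those of \<open>d\<close> through \<open>K\<close> alone.\<close>

lemma fc_second_fundamental_form:
  assumes n0: "fd Fd yd \<nu> $ 0 = 0" "\<And>v. bil (Gd yd) (slice2 v) \<nu> = 0"
  shows "second_fundamental_form (\<lambda>_. mat 1) fc uc (spatial (fd Fd yd \<nu>)) $ A $ B =
    - bil minkowski (fd (\<lambda>y. fd Fd y (slice2 (K (axis B 1)))) yd (slice2 (K (axis A 1)))) (fd Fd yd \<nu>)"
proof -
  define \<nu>0 where "\<nu>0 = spatial (fd Fd yd \<nu>)"
  have \<nu>0: "\<nu>0 \<bullet> spatial x = bil minkowski x (fd Fd yd \<nu>)" for x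
    by (simp add: \<nu>0_def bil_minkowski n0 inner_commute)
  define L where "L y = \<nu>0 \<bullet> spatial y" for y
  have L: "bounded_linear L"
    unfolding L_def using bounded_linear_compose[OF bounded_linear_inner_right bounded_linear_spatial] .
  \<comment> \<open>The height of the image of S over its tangent plane, up to a constant, in the
    surface coordinates of \<open>d\<close>.\<close>
  define r where "r z = L (Fd (slice2 z))" for z
  have dF: "(\<lambda>u. Fd (slice2 u)) differentiable (at z)" "Fd differentiable (at (slice2 z))"
    "(\<lambda>y. fd Fd y v) differentiable (at (slice2 z))" if "z \<in> Wd" for z v
    using that twice_differentiable_onD[OF Fd_diff, of "slice2 z"]
      differentiable_chain_at[OF bounded_linear_imp_differentiable[OF bounded_linear_slice2], of Fd]
    by (simp_all add: o_def)
  have fdr: "fd r z v = L (fd Fd (slice2 z) (slice2 v))" if "z \<in> Wd" for z v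
    using fd_linear_compose[OF dF(1)[OF that] L] fd_compose_linear[OF bounded_linear_slice2 dF(2)[OF that]]
    by (simp add: r_def[abs_def])
  have r: "twice_differentiable_on Wd r"
  proof -
    have "twice_differentiable_on Wd (\<lambda>u. Fd (slice2 u))"
      by (rule twice_differentiable_on_compose[OF open_Wd twice_differentiable_on_linear[OF bounded_linear_slice2] Fd_diff]) auto
    from twice_differentiable_on_compose[OF open_Wd this twice_differentiable_on_linear[OF L, of UNIV]]
    show ?thesis by (simp add: r_def[abs_def])
  qed
  \<comment> \<open>The matching of metrics at the point turns orthogonality of \<open>\<nu>\<close>
    to S into orthogonality of its image to the image of S.\<close>
  have crit: "fd r (\<kappa>2 uc) v = 0" for v
    using fdr[OF ud_Wd] \<nu>0 n0(2)[of v] matching[of ud] yd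
      bil_pullback_metric[OF twice_differentiable_onD(1)[OF Fd_diff yd]]
    by (simp add: \<kappa>2_uc L_def)
  have rc: "\<nu>0 \<bullet> fc u = r (\<kappa>2 u)" if "u \<in> Wc" for u
    using that Fc_eq[of "slice2 u"] \<kappa>2[OF that] by (simp add: r_def L_def)
  note dfc = twice_differentiable_onD[OF fc_diff]
  have "\<nu>0 \<bullet> pd (pd fc B) A uc = \<nu>0 \<bullet> fd (\<lambda>u. fd fc u (axis B 1)) uc (axis A 1)"
    by (simp add: pd_def[abs_def])
  also have "\<dots> = fd (\<lambda>u. \<nu>0 \<bullet> fd fc u (axis B 1)) uc (axis A 1)"
    by (rule fd_linear_compose[OF dfc(2)[OF uc_Wc] bounded_linear_inner_right, symmetric])
  also have "\<dots> = fd (\<lambda>u. fd (\<lambda>u. r (\<kappa>2 u)) u (axis B 1)) uc (axis A 1)"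
  proof (rule fun_cong[OF fd_cong_open[OF open_Wc uc_Wc]])
    fix u assume u: "u \<in> Wc"
    have "\<nu>0 \<bullet> fd fc u (axis B 1) = fd (\<lambda>u. \<nu>0 \<bullet> fc u) u (axis B 1)"
      by (rule fd_linear_compose[OF dfc(1)[OF u] bounded_linear_inner_right, symmetric])
    also have "\<dots> = fd (\<lambda>u. r (\<kappa>2 u)) u (axis B 1)"
      by (rule fun_cong[OF fd_cong_open[OF open_Wc u]]) (rule rc)
    finally show "\<nu>0 \<bullet> fd fc u (axis B 1) = fd (\<lambda>u. r (\<kappa>2 u)) u (axis B 1)" .
  qed
  also have "\<dots> = fd (\<lambda>z. fd r z (K (axis B 1))) (\<kappa>2 uc) (K (axis A 1))"
    by (rule hessian_compose_critical[OF open_Wc uc_Wc \<kappa>2_diff open_Wd r \<kappa>2_Wd crit])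
  also have "\<dots> = fd (\<lambda>z. L (fd Fd (slice2 z) (slice2 (K (axis B 1))))) ud (K (axis A 1))"
    unfolding \<kappa>2_uc by (rule fun_cong[OF fd_cong_open[OF open_Wd ud_Wd]]) (rule fdr)
  also have "\<dots> = L (fd (\<lambda>z. fd Fd (slice2 z) (slice2 (K (axis B 1)))) ud (K (axis A 1)))"
  proof (rule fd_linear_compose[OF _ L])
    show "(\<lambda>z. fd Fd (slice2 z) (slice2 (K (axis B 1)))) differentiable (at ud)"
      using differentiable_chain_at[OF bounded_linear_imp_differentiable[OF bounded_linear_slice2] dF(3)[OF ud_Wd]]
      by (simp add: o_def)
  qed
  also have "\<dots> = L (fd (\<lambda>y. fd Fd y (slice2 (K (axis B 1)))) yd (slice2 (K (axis A 1))))"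
    using fd_compose_linear[OF bounded_linear_slice2 dF(3)[OF ud_Wd]] by simp
  finally show ?thesis
    by (simp add: second_fundamental_form_euclidean \<nu>0_def[symmetric] L_def \<nu>0)
qed

section \<open>Matching of the normals and of the densities\<close>

lemma bil_Gc_transition: "bil (Gc yc) v w = bil (Gd yd) (J v) (J w)"
  by (simp add: Gc_eq[OF uc(1)] uc(2))

lemma bil_Gc_reference: "bil (Gc yc) v w = bil minkowski (fd Fc yc v) (fd Fc yc w)"
  unfolding Gc_Bc Bc_eq[OF uc(1)] by (rule bil_pullback_metric[OF twice_differentiable_onD(1)[OF Fc_diff uc(1)]])

lemma bil_Gc_commute: "bil (Gc yc) v w = bil (Gc yc) w v"
  unfolding bil_Gc_reference by (rule bil_commute[OF transpose_minkowski])

lemma first_fundamental_form: "pullback_metric Gc slice2 uc = (\<chi> A B. bil (Gc yc) (slice2 (axis A 1)) (slice2 (axis B 1)))"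
  by (simp add: pullback_metric_def pd_def fd_bounded_linear[OF bounded_linear_slice2])

lemma first_fundamental_form_transition: "pullback_metric Gc slice2 uc =
    (\<chi> A B. bil (Gd yd) (slice2 (K (axis A 1))) (slice2 (K (axis B 1))))"
  by (simp add: first_fundamental_form bil_Gc_transition J_slice2)

lemma fd_Fc_time: "fd Fc yc (slice2 v) $ 0 = 0"
  using fd_Fc[OF uc(1), of "slice2 v"] fd_Fd_time by (simp add: uc(2) J_slice2)

text \<open>The vector \<open>N\<close> goes to the time direction and is orthogonal to
  \<open>\<nu>\<close>, so the image of \<open>\<nu>\<close> is purely spatial. Unit length and
  orthogonality then follow from the matching of metrics, and \<open>outward\<close> fixes the
  sign.\<close>

lemma fc_outward_normal:
  assumes unit: "bil (Gd yd) (slice3 n) (slice3 n) = 1" and perp: "\<And>v. bil (Gd yd) (slice2 v) (slice3 n) = 0"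
    and \<nu>: "J \<nu> = slice3 n" and N: "fd Fc yc N = axis 0 1" "bil (Gc yc) N \<nu> = 0"
    and outward: "points_outward \<Sigma> (fc uc) (spatial (fd Fc yc \<nu>))"
    and \<sigma>_pos: "0 < det (pullback_metric Gc slice2 uc)"
  shows "euclidean_outward_normal \<Sigma> fc uc = spatial (fd Fc yc \<nu>)"
proof (rule euclidean_outward_normal_eq[where f = fc and u = uc, OF _ _ outward])
  have "fd Fc yc \<nu> $ 0 = 0"
    using N(2) unfolding bil_Gc_reference N(1) by (simp add: bil_minkowski spatial_def inner_vec_def sum_3 axis_def)
  then have inner: "spatial (fd Fc yc \<nu>) \<bullet> spatial (fd Fc yc v) = bil (Gc yc) \<nu> v" for v
    by (simp add: bil_Gc_reference bil_minkowski)
  show "norm (spatial (fd Fc yc \<nu>)) = 1"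
    by (simp add: norm_eq_1 inner bil_Gc_transition \<nu> unit)
  show "spatial (fd Fc yc \<nu>) \<bullet> pd fc A uc = 0" for A
    unfolding pd_def fd_fc[OF uc_Wc] inner unfolding bil_Gc_commute[of \<nu>] unfolding bil_Gc_transition \<nu> J_slice2 by (rule perp)
  show "det (pullback_metric (\<lambda>_. mat 1) fc uc) \<noteq> 0"
    using \<sigma>_pos by (simp add: fc_first_fundamental_form first_fundamental_form_transition)
qed

text \<open>With the connection difference reduced to \<open>D\<close>, the left-hand side is minus
  the area density times the trace of \<open>D \<nu>\<close>, while the difference of mean
  curvatures is minus half that trace; hence the factor 2.\<close>

lemma cnt_density:
  assumes unit: "bil (Gd yd) (slice3 n) (slice3 n) = 1" and perp: "\<And>v. bil (Gd yd) (slice2 v) (slice3 n) = 0"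
    and \<nu>: "J \<nu> = slice3 n" and N: "fd Fc yc N = axis 0 1" and N_perp: "bil (Gc yc) N \<nu> = 0"
    and orient: "0 < det ((\<chi> i. if i = 0 then N else if i = 1 then \<nu> else axis i 1) :: real^4^4)"
    and nondeg: "det (pullback_metric Gd slice3 (emb2 ud)) \<noteq> 0"
    and \<sigma>_pos: "0 < det (pullback_metric Gc slice2 uc)"
  defines "C \<equiv> \<lambda>a m b. christoffel Gc a m b yc - christoffel Bc a m b yc"
  shows "(\<Sum>a\<in>UNIV. \<Sum>b\<in>UNIV. C a 2 b * eta_form (Gc yc) a b N (axis 3 1) - C a 3 b * eta_form (Gc yc) a b N (axis 2 1)) =
    2 * (mean_curvature (\<lambda>_. mat 1) fc uc (spatial (fd Fc yc \<nu>))
      - mean_curvature (pullback_metric Gd slice3) emb2 ud n) * sqrt (det (pullback_metric Gc slice2 uc))"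
proof -
  let ?\<sigma> = "pullback_metric Gc slice2 uc"
  let ?e = "\<lambda>A. slice2 (axis A 1)" and ?Ke = "\<lambda>A. slice2 (K (axis A 1))"
  define D where "D X v w = bil (fd Ec yc X) v w" for X v w
  have fFc: "fd Fc yc \<nu> = fd Fd yd (slice3 n)"
    using fd_Fc[OF uc(1), of \<nu>] by (simp add: uc(2) \<nu>)
  have time\<nu>: "fd Fd yd (slice3 n) $ 0 = 0"
    using N_perp unfolding bil_Gc_reference N fFc by (simp add: bil_minkowski spatial_def inner_vec_def sum_3 axis_def)
  have q_bilinear: "bilinear (\<lambda>v w. 1/2 * (bil (fd Gd yd (slice2 v)) (slice3 n) (slice2 w)
      + bil (fd Gd yd (slice2 w)) (slice3 n) (slice2 v) - bil (fd Gd yd (slice3 n)) (slice2 v) (slice2 w)))"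
    (is "bilinear ?q")
  proof -
    have lin: "linear (fd Gd yd)" "linear slice2"
      using linear_fd[OF Gd_diff] bounded_linear.linear[OF bounded_linear_slice2] by blast+
    show ?thesis
      using lin by (auto simp: bilinear_def linear_iff bil_add_scaleR algebra_simps add_divide_distrib)
  qed
  have Gd_bilinear: "bilinear (\<lambda>v w. bil (Gd yd) (slice2 v) (slice2 w))"
    using bounded_linear.linear[OF bounded_linear_slice2]
    by (auto simp: bilinear_def linear_iff bil_add_scaleR)

  \<comment> \<open>The form \<open>?q\<close> is minus the second fundamental form of S in the
    domain. It lives in the coordinates of \<open>d\<close> and is pulled back by \<open>K\<close>,
    so that both traces use the same first fundamental form \<open>?\<sigma>\<close>.\<close>
  have kd: "mean_curvature (pullback_metric Gd slice3) emb2 ud n =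
    (\<Sum>A\<in>UNIV. \<Sum>B\<in>UNIV. matrix_inv ?\<sigma> $ A $ B * - ?q (K (axis A 1)) (K (axis B 1)))"
  proof -
    have Gd': "Gd differentiable (at (slice3 (emb2 ud)))" using Gd_diff by (simp add: slice3_emb2)
    have \<sigma>': "pullback_metric (pullback_metric Gd slice3) emb2 ud = (\<chi> A B. bil (Gd yd) (?e A) (?e B))"
      by (simp add: pullback_metric_def[of "pullback_metric Gd slice3"] pd_def fd_bounded_linear[OF bounded_linear_emb2]
        pullback_slice3(1)[OF Gd'] slice3_emb2)
    have \<sigma>1: "?\<sigma> = transpose (matrix K) ** pullback_metric (pullback_metric Gd slice3) emb2 ud ** matrix K"
      unfolding first_fundamental_form_transition \<sigma>' by (rule congruence_of_form[OF Gd_bilinear linear_K])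
    have "(\<Sum>A\<in>UNIV. \<Sum>B\<in>UNIV. matrix_inv ?\<sigma> $ A $ B * (\<chi> A B. ?q (K (axis A 1)) (K (axis B 1))) $ A $ B) =
      (\<Sum>A\<in>UNIV. \<Sum>B\<in>UNIV. matrix_inv (pullback_metric (pullback_metric Gd slice3) emb2 ud) $ A $ B *
        (\<chi> A B. ?q (axis A 1) (axis B 1)) $ A $ B)"
      by (rule metric_trace_congruence[OF \<sigma>1 congruence_of_form[OF q_bilinear linear_K]]) (use \<sigma>_pos in simp)
    then show ?thesis
      by (simp add: mean_curvature_def second_fundamental_form_domain[OF Gd_diff Gd_sym[OF yd] nondeg] sum_negf)
  qed
  have kc: "mean_curvature (\<lambda>_. mat 1) fc uc (spatial (fd Fc yc \<nu>)) =
    (\<Sum>A\<in>UNIV. \<Sum>B\<in>UNIV. matrix_inv ?\<sigma> $ A $ B *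
      - bil minkowski (fd (\<lambda>y. fd Fd y (?Ke B)) yd (?Ke A)) (fd Fd yd (slice3 n)))"
    unfolding mean_curvature_def fFc fc_first_fundamental_form first_fundamental_form_transition[symmetric]
      fc_second_fundamental_form[OF time\<nu> perp] ..
  \<comment> \<open>In \<open>?q\<close> split \<open>Gd\<close> as \<open>Ed + Bd\<close>. The flat
    part gives exactly the second derivative of the reference; of the three \<open>Ed\<close> terms,
    those differentiating along the surface vanish.\<close>
  have diff: "?q (K (axis A 1)) (K (axis B 1))
      - bil minkowski (fd (\<lambda>y. fd Fd y (?Ke B)) yd (?Ke A)) (fd Fd yd (slice3 n)) = - 1/2 * D \<nu> (?e A) (?e B)" for A B
  proof -
    have fdG: "fd Gd yd X = fd Ed yd X + fd Bd yd X" for X using fd_Ed by simp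
    have z: "bil (0 :: real^4^4) x z = 0" for x z by (simp add: bil_def)
    show ?thesis
      using minkowski_pullback_christoffel[OF open_Vd yd Fd_diff, of "?Ke A" "slice3 n" "?Ke B"]
        second_derivative_symmetric[OF open_Vd yd Fd_diff, of "?Ke B" "?Ke A"]
      unfolding fdG bil_add_scaleR fd_Ed_tangent z D_def fd_Ec_tensor \<nu> J_slice2
      by (simp add: algebra_simps)
  qed

  \<comment> \<open>The frame matrix in the coordinates of \<open>c\<close>: its determinant is the
    one in the orientation hypothesis, and its Gram matrix is adapted because \<open>N\<close> is
    matched with the unit time direction.\<close>
  define P where "P = transpose ((\<chi> i. if i = 0 then N else if i = 1 then \<nu> else axis i 1) :: real^4^4)"
  have col: "column 0 P = N" "column 1 P = \<nu>" "column 2 P = axis 2 1" "column 3 P = axis 3 1"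
    by (simp_all add: P_def column_def transpose_def vec_eq_iff)
  have detP: "det P > 0" using orient by (simp add: P_def)
  have tan: "bil (Gc yc) N (slice2 v) = 0" "bil (Gc yc) \<nu> (slice2 v) = 0" for v
  proof -
    show "bil (Gc yc) N (slice2 v) = 0"
      unfolding bil_Gc_reference N by (simp add: bil_minkowski spatial_def inner_vec_def sum_3 axis_def fd_Fc_time)
    show "bil (Gc yc) \<nu> (slice2 v) = 0"
      unfolding bil_Gc_commute[of \<nu>] unfolding bil_Gc_transition \<nu> J_slice2 by (rule perp)
  qed
  have NN: "bil (Gc yc) N N = - 1"
    unfolding bil_Gc_reference N by (simp add: bil_minkowski spatial_def inner_vec_def sum_3 axis_def)
  have \<nu>\<nu>: "bil (Gc yc) \<nu> \<nu> = 1" by (simp add: bil_Gc_transition \<nu> unit)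
  have gram: "transpose P ** Gc yc ** P = adapted ?\<sigma>"
  proof -
    have "(transpose P ** Gc yc ** P) $ i $ j = bil (Gc yc) (column i P) (column j P)" for i j
      by (simp only: bil_axis[symmetric] bil_matrix_mult matrix_vector_mult_basis)
    then show ?thesis
      using tan[of "axis 1 1"] tan[of "axis 2 1"] N_perp NN \<nu>\<nu>
        bil_Gc_commute[of "axis 2 1" N] bil_Gc_commute[of "axis 3 1" N] bil_Gc_commute[of "axis 2 1" \<nu>] bil_Gc_commute[of "axis 3 1" \<nu>] bil_Gc_commute[of \<nu> N]
      by (simp add: vec_eq_iff all_4 adapted_def col first_fundamental_form slice2_axis)
  qed
  have \<sigma>_sym: "transpose ?\<sigma> = ?\<sigma>"
    unfolding first_fundamental_form using bil_Gc_commute by (simp add: transpose_def vec_eq_iff)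
  have Ec_diff: "Ec differentiable (at yc)" by (intro differentiable_diff Gc_diff Bc_diff)
  have D_lin: "linear (\<lambda>X. D X v w)" for v w
    using linear_fd[OF Ec_diff] by (auto simp: D_def linear_iff bil_add_scaleR)
  have D_sym: "D X v w = D X w v" for X v w
    unfolding D_def fd_Ec_tensor by (rule fd_Ed_symmetric)
  have D_slice: "D (slice2 u) v w = 0" for u v w
    unfolding D_def fd_Ec_tensor J_slice2 fd_Ed_tangent by (simp add: bil_def)
  have D_tan: "D (axis 2 1) v w = 0" "D (axis 3 1) v w = 0" for v w
    using D_slice[of "axis 1 1"] D_slice[of "axis 2 1"] by (simp_all add: slice2_axis)
  \<comment> \<open>At the point the two metrics have the same inverse, so the difference of the
    Christoffel symbols is linear in the derivative of \<open>Ec\<close>.\<close>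
  have C: "C a m b = 1/2 * (\<Sum>d\<in>UNIV. matrix_inv (Gc yc) $ a $ d *
      (D (axis m 1) (axis d 1) (axis b 1) + D (axis b 1) (axis d 1) (axis m 1) - D (axis d 1) (axis m 1) (axis b 1)))" for a m b
    unfolding C_def christoffel_def pd_entry[OF Gc_diff] pd_entry[OF Bc_diff] Gc_Bc[symmetric] D_def fd_Ec bil_diff
    by (simp add: sum_subtractf[symmetric] algebra_simps flip: right_diff_distrib)
  have "(\<Sum>a\<in>UNIV. \<Sum>b\<in>UNIV. C a 2 b * eta_form (Gc yc) a b N (axis 3 1) - C a 3 b * eta_form (Gc yc) a b N (axis 2 1)) =
    - sqrt (det ?\<sigma>) * (\<Sum>A\<in>UNIV. \<Sum>B\<in>UNIV. matrix_inv ?\<sigma> $ A $ B * D \<nu> (?e A) (?e B))"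
    by (rule cnt_contraction[OF _ D_lin D_sym D_tan gram \<sigma>_pos \<sigma>_sym detP col C])
      (simp add: D_def bilinear_bil)
  also have "(\<Sum>A\<in>UNIV. \<Sum>B\<in>UNIV. matrix_inv ?\<sigma> $ A $ B * D \<nu> (?e A) (?e B)) =
    - 2 * (mean_curvature (\<lambda>_. mat 1) fc uc (spatial (fd Fc yc \<nu>)) - mean_curvature (pullback_metric Gd slice3) emb2 ud n)"
  proof -
    have D': "D \<nu> (?e A) (?e B) = - 2 * (?q (K (axis A 1)) (K (axis B 1))
      - bil minkowski (fd (\<lambda>y. fd Fd y (?Ke B)) yd (?Ke A)) (fd Fd yd (slice3 n)))" for A B
      unfolding diff by simp
    show ?thesis
      unfolding kc kd D' sum_subtractf[symmetric] sum_distrib_left[of "- 2 :: real"]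
      by (intro sum.cong refl) (simp add: algebra_simps)
  qed
  finally show ?thesis by (simp add: algebra_simps)
qed

end

section \<open>Normals and the comparison of the integrands\<close>

lemma pos_def_det_nz:
  fixes H :: "real^'n^'n"
  assumes "\<And>v. v \<noteq> 0 \<Longrightarrow> bil H v v > 0"
  shows "det H \<noteq> 0"
proof -
  have "x = 0" if "H *v x = 0" for x
  proof (rule ccontr)
    assume "x \<noteq> 0"
    from assms[OF this] that show False by (simp add: bil_def)
  qed
  then have "\<exists>B. B ** H = mat 1" by (simp add: matrix_left_invertible_ker)
  then show ?thesis by (metis det_I det_mul mult_zero_right zero_neq_one)
qed

lemma pos_def_det_2:
  fixes H :: "real^2^2"
  assumes pos: "\<And>v. v \<noteq> 0 \<Longrightarrow> bil H v v > 0" and sym: "transpose H = H"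
  shows "det H > 0"
proof -
  have e: "(axis 1 1 :: real^2) \<noteq> 0" by (simp add: axis_eq_0_iff)
  have H11: "H $ 1 $ 1 > 0" using pos[OF e] by (simp add: bil_axis)
  have H21: "H $ 2 $ 1 = H $ 1 $ 2"
    using arg_cong[OF sym, of "\<lambda>M. M $ 1 $ 2"] by (simp add: transpose_def)
  \<comment> \<open>Chosen so that \<open>bil H ?v ?v\<close> is
    \<open>H $ 1 $ 1 * det H\<close>.\<close>
  let ?v = "vector [- H $ 1 $ 2, H $ 1 $ 1] :: real^2"
  have "?v \<noteq> 0" using H11 by (auto simp: vec_eq_iff forall_2)
  from pos[OF this] have "H $ 1 $ 1 * det H > 0"
    by (simp add: bil_sum sum_2 det_2 H21 algebra_simps)
  then show ?thesis using H11 by (simp add: zero_less_mult_iff)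
qed

text \<open>Justifies the \<open>THE\<close> in \<open>outward_normal_in\<close>. The condition on
  the first coordinate selects the side, since the domain lies where that coordinate is
  nonpositive.\<close>

lemma unit_normal_ex1:
  fixes H :: "real^3^3"
  assumes pos: "\<And>v. v \<noteq> 0 \<Longrightarrow> bil H v v > 0" and sym: "transpose H = H"
  shows "\<exists>!n. bil H n n = 1 \<and> bil H n (axis 2 1) = 0 \<and> bil H n (axis 3 1) = 0 \<and> n $ 1 > 0"
proof -
  have H: "H $ 2 $ 1 = H $ 1 $ 2" "H $ 3 $ 1 = H $ 1 $ 3" "H $ 3 $ 2 = H $ 2 $ 3"
    using arg_cong[OF sym, of "\<lambda>M. M $ 1 $ 2"] arg_cong[OF sym, of "\<lambda>M. M $ 1 $ 3"]
      arg_cong[OF sym, of "\<lambda>M. M $ 2 $ 3"] by (simp_all add: transpose_def)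
  \<comment> \<open>the cross product of \<open>H e\<^sub>2\<close> and \<open>H e\<^sub>3\<close>\<close>
  define w :: "real^3" where "w = vector [H$2$2 * H$3$3 - H$2$3 * H$2$3, H$2$3 * H$1$3 - H$1$2 * H$3$3, H$1$2 * H$2$3 - H$2$2 * H$1$3]"
  have w2: "bil H w (axis 2 1) = 0" and w3: "bil H w (axis 3 1) = 0"
    by (simp_all add: bil_sum sum_3 w_def H axis_def algebra_simps)
  have w1: "w $ 1 > 0"
  proof -
    have H22: "H $ 2 $ 2 > 0" using pos[of "axis 2 1"] by (simp add: bil_axis axis_eq_0_iff)
    \<comment> \<open>Chosen so that \<open>bil H ?v ?v\<close> is
      \<open>H $ 2 $ 2 * w $ 1\<close>.\<close>
    let ?v = "vector [0, - H $ 2 $ 3, H $ 2 $ 2] :: real^3"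
    have "?v \<noteq> 0" using H22 by (auto simp: vec_eq_iff forall_3)
    from pos[OF this] have "H $ 2 $ 2 * w $ 1 > 0"
      by (simp add: bil_sum sum_3 w_def H algebra_simps)
    then show ?thesis using H22 by (simp add: zero_less_mult_iff)
  qed
  then have "w \<noteq> 0" by auto
  then have ww: "bil H w w > 0" by (rule pos)
  let ?n = "(1 / sqrt (bil H w w)) *\<^sub>R w"
  have n: "bil H ?n ?n = 1 \<and> bil H ?n (axis 2 1) = 0 \<and> bil H ?n (axis 3 1) = 0 \<and> ?n $ 1 > 0"
    using ww w1 w2 w3 by (simp add: bil_add_scaleR)
  have "n = m" if n: "bil H n n = 1 \<and> bil H n (axis 2 1) = 0 \<and> bil H n (axis 3 1) = 0 \<and> n $ 1 > 0"
    and m: "bil H m m = 1 \<and> bil H m (axis 2 1) = 0 \<and> bil H m (axis 3 1) = 0 \<and> m $ 1 > 0" for n m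
  proof -
    \<comment> \<open>This combination has no first coordinate, so it lies in the span of the two
      tangent directions; being also orthogonal to that span, it has length zero.\<close>
    define x where "x = (m $ 1) *\<^sub>R n + (- n $ 1) *\<^sub>R m"
    have x1: "x $ 1 = 0" by (simp add: x_def)
    have "x = (x $ 2) *\<^sub>R axis 2 1 + (x $ 3) *\<^sub>R axis 3 1"
      using x1 by (simp add: vec_eq_iff forall_3 axis_def)
    then have "bil H x x = bil H x ((x $ 2) *\<^sub>R axis 2 1 + (x $ 3) *\<^sub>R axis 3 1)"
      by (rule arg_cong)
    also have "\<dots> = x $ 2 * bil H x (axis 2 1) + x $ 3 * bil H x (axis 3 1)"
      by (simp only: bil_add_scaleR)
    also have "\<dots> = 0"
      unfolding x_def bil_add_scaleR using n m by simp
    finally have "bil H x x = 0" .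
    then have "x = 0" using pos by force
    then have eq: "(m $ 1) *\<^sub>R n = (n $ 1) *\<^sub>R m" by (simp add: x_def)
    have "(m $ 1)\<^sup>2 = bil H ((m $ 1) *\<^sub>R n) ((m $ 1) *\<^sub>R n)"
      using n by (simp add: bil_add_scaleR power2_eq_square)
    also have "\<dots> = (n $ 1)\<^sup>2"
      unfolding eq using m by (simp add: bil_add_scaleR power2_eq_square)
    finally have "m $ 1 = n $ 1" using n m by (auto simp: power2_eq_iff)
    with eq have "(n $ 1) *\<^sub>R n = (n $ 1) *\<^sub>R m" by (simp only:)
    then have "n $ 1 = 0 \<or> n = m" by auto
    then show "n = m" using n by (metis less_irrefl)
  qed
  with n show ?thesis by blast
qed

lemma slice3_time: "slice3 v $ 0 = 0"
  by (simp add: slice3_def)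

lemma slice2_time: "slice2 v $ 0 = 0" "slice2 v $ 1 = 0"
  by (simp_all add: slice2_def)

lemma slice3_eq_0: "slice3 v = 0 \<Longrightarrow> v = 0"
  by (metis spatial_slice3 bounded_linear_spatial linear_0 bounded_linear.linear)

lemma slice2_eq_0: "slice2 v = 0 \<Longrightarrow> v = 0"
  by (auto simp: slice2_def vec_eq_iff all_4 forall_2 split: if_splits)

lemma emb2_decompose: "emb2 v = (v $ 1) *\<^sub>R axis 2 1 + (v $ 2) *\<^sub>R axis 3 1"
  by (simp add: vec_eq_iff forall_3 axis_def)

lemma transpose_pullback_metric:
  assumes "transpose (G (f y)) = G (f y)"
  shows "transpose (pullback_metric G f y) = pullback_metric G f y"
  using bil_commute[OF assms] by (simp add: transpose_def pullback_metric_def vec_eq_iff)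


section \<open>From tensors on the manifold to their coordinate expressions\<close>

lemma metric_coord_snd:
  "is_chart c \<Longrightarrow> p \<in> fst c \<Longrightarrow> metric_coord g c (snd c p) = g c p"
  by (simp add: metric_coord_def is_chartD(2))

lemma lorentzian_metricD:
  assumes "lorentzian_metric A g" "c \<in> oriented_charts A" "p \<in> fst c"
  shows "transpose (g c p) = g c p" "metric_coord g c differentiable (at (snd c p))"
    "\<And>d. d \<in> oriented_charts A \<Longrightarrow> p \<in> fst d \<Longrightarrow> g c p = transpose (jac c d p) ** g d p ** jac c d p"
proof -
  show "transpose (g c p) = g c p"
    "\<And>d. d \<in> oriented_charts A \<Longrightarrow> p \<in> fst d \<Longrightarrow> g c p = transpose (jac c d p) ** g d p ** jac c d p"
    using assms unfolding lorentzian_metric_def by blast+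
  have "smooth_on (snd c ` fst c) (metric_coord g c)"
    using assms unfolding lorentzian_metric_def by blast
  from twice_differentiable_onD(1)[OF smooth_on_imp_twice_differentiable_on[OF this]]
  show "metric_coord g c differentiable (at (snd c p))" using assms(3) by blast
qed

lemma slice2_surf_coord:
  assumes "slice_chart A S c" "p \<in> S \<inter> fst c"
  shows "slice2 (surf_coord c p) = snd c p"
  unfolding surf_coord_def by (rule slice2_eqI) (use assms in \<open>auto simp: slice_chart_def\<close>)

text \<open>The coordinate domains are cut down to \<open>U\<close>, where the reference is smooth,
  and that of \<open>c\<close> also to the domain of \<open>d\<close>, so that the transition map is
  defined on all of it.\<close>

lemma matched_charts_slice:
  fixes A :: "('m::{t2_space,second_countable_topology}) chart set"
  assumes M: "spacetime A g \<tau>" and \<phi>: "isometric_matching_reference A g \<tau> S U \<phi>" "\<phi> ` S \<subseteq> {y. y $ 0 = t}"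
    and c: "slice_chart A S c" and d: "slice_chart A S d" and p: "p \<in> S \<inter> fst c \<inter> fst d"
  shows "matched_charts (snd c ` (fst c \<inter> (fst d \<inter> U))) (snd d ` (fst d \<inter> U)) (\<lambda>y. snd d (chart_inv c y))
    (\<phi> \<circ> chart_inv c) (\<phi> \<circ> chart_inv d) (metric_coord g c) (metric_coord g d)
    (metric_coord (pullback_minkowski \<phi>) c) (surf_coord c p) (surf_coord d p) t"
proof -
  have A: "oriented_atlas A" and g: "lorentzian_metric A g"
    using M by (auto simp: spacetime_def)
  have co: "c \<in> oriented_charts A" and do: "d \<in> oriented_charts A"
    using c d by (auto simp: slice_chart_def)
  note cc = oriented_charts_is_chart[OF co] and dc = oriented_charts_is_chart[OF do]
  note cD = is_chartD[OF cc] and dD = is_chartD[OF dc]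
  have U: "open U" "S \<subseteq> U"
    and iso: "\<And>c p. c \<in> oriented_charts A \<Longrightarrow> p \<in> S \<inter> fst c \<Longrightarrow> pullback_minkowski \<phi> c p = g c p"
    and \<phi>d: "smooth_on (snd d ` (U \<inter> fst d)) (\<phi> \<circ> chart_inv d)"
    using \<phi>(1) do by (auto simp: isometric_matching_reference_def reference_def)
  have cp: "slice2 (surf_coord c p) = snd c p" and dp: "slice2 (surf_coord d p) = snd d p"
    using slice2_surf_coord c d p by blast+
  \<comment> \<open>In a slice chart the two equations of S hold at every point of the form
    \<open>slice2 u\<close>; this turns hypotheses about S into identities on open sets of
    parameters.\<close>
  have onS: "q \<in> S" if "e \<in> {c, d}" "q \<in> fst e" "slice2 u = snd e q" for e q u
    using that c d slice2_time[of u] by (auto simp: slice_chart_def)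
  show ?thesis
  proof
    show "open (snd c ` (fst c \<inter> (fst d \<inter> U)))" "open (snd d ` (fst d \<inter> U))"
      using open_chart_image[OF cc, of "fst d \<inter> U"] open_chart_image[OF dc U(1)] dD(1) U(1) by auto
    show "(\<lambda>y. snd d (chart_inv c y)) ` snd c ` (fst c \<inter> (fst d \<inter> U)) \<subseteq> snd d ` (fst d \<inter> U)"
      using cD(2) by auto
    show "twice_differentiable_on (snd c ` (fst c \<inter> (fst d \<inter> U))) (\<lambda>y. snd d (chart_inv c y))"
      by (rule twice_differentiable_on_subset[OF transition_twice_differentiable[OF A co do]]) auto
    show "twice_differentiable_on (snd d ` (fst d \<inter> U)) (\<phi> \<circ> chart_inv d)"
      using smooth_on_imp_twice_differentiable_on[OF \<phi>d] by (simp add: Int_commute)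
    show "(\<phi> \<circ> chart_inv c) y = (\<phi> \<circ> chart_inv d) (snd d (chart_inv c y))"
      if "y \<in> snd c ` (fst c \<inter> (fst d \<inter> U))" for y
      using that cD(2) dD(2) by auto
    show "metric_coord g d differentiable (at (slice2 (surf_coord d p)))"
      "metric_coord g c differentiable (at (slice2 (surf_coord c p)))"
      using lorentzian_metricD(2)[OF g] co do p by (simp_all add: cp dp)
    show "transpose (metric_coord g d y) = metric_coord g d y" if "y \<in> snd d ` (fst d \<inter> U)" for y
      using that lorentzian_metricD(1)[OF g do] metric_coord_snd[OF dc, of _ g] by auto
    show "bil (metric_coord g c y) v w = bil (metric_coord g d (snd d (chart_inv c y)))
        (fd (\<lambda>y. snd d (chart_inv c y)) y v) (fd (\<lambda>y. snd d (chart_inv c y)) y w)"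
      if y: "y \<in> snd c ` (fst c \<inter> (fst d \<inter> U))" for y v w
    proof -
      obtain q where q: "q \<in> fst c" "q \<in> fst d" "y = snd c q" using y by blast
      have qq: "q \<in> fst c \<inter> fst d" using q by simp
      show ?thesis
        using lorentzian_metricD(3)[OF g co q(1) do q(2)] jac_mult[OF A co do qq]
        by (simp add: q cD(2) metric_coord_snd cc dc bil_matrix_mult)
    qed
    show "metric_coord (pullback_minkowski \<phi>) c y = minkowski_pullback (\<phi> \<circ> chart_inv c) y"
      if "y \<in> snd c ` (fst c \<inter> (fst d \<inter> U))" for y
      using that by (auto simp: metric_coord_def pullback_minkowski_def cD(2))
    show "slice2 (surf_coord c p) \<in> snd c ` (fst c \<inter> (fst d \<inter> U))"
      using p U(2) by (auto simp: cp)
    show "snd d (chart_inv c (slice2 (surf_coord c p))) = slice2 (surf_coord d p)"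
      using p by (simp add: cp dp cD(2))
    show "snd d (chart_inv c (slice2 u)) $ 0 = 0" "snd d (chart_inv c (slice2 u)) $ 1 = 0"
      if u: "slice2 u \<in> snd c ` (fst c \<inter> (fst d \<inter> U))" for u
    proof -
      obtain q where q: "q \<in> fst c" "q \<in> fst d" "slice2 u = snd c q" using u by blast
      have "q \<in> S \<inter> fst d" using onS[of c q u] q by simp
      then show "snd d (chart_inv c (slice2 u)) $ 0 = 0" "snd d (chart_inv c (slice2 u)) $ 1 = 0"
        using d q by (auto simp: cD(2) slice_chart_def)
    qed
    show "metric_coord g d (slice2 u) = minkowski_pullback (\<phi> \<circ> chart_inv d) (slice2 u)"
      "(\<phi> \<circ> chart_inv d) (slice2 u) $ 0 = t"
      if u: "slice2 u \<in> snd d ` (fst d \<inter> U)" for u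
    proof -
      obtain q where q: "q \<in> fst d" "slice2 u = snd d q" using u by blast
      have "q \<in> S \<inter> fst d" using onS[of d q u] q by simp
      then show "metric_coord g d (slice2 u) = minkowski_pullback (\<phi> \<circ> chart_inv d) (slice2 u)"
        "(\<phi> \<circ> chart_inv d) (slice2 u) $ 0 = t"
        using iso[OF do, of q] \<phi>(2) q
        by (auto simp: metric_coord_snd dc pullback_minkowski_def dD(2))
    qed
  qed
qed

text \<open>The domain is spacelike, so the induced metric at the point is positive definite. This
  makes the description of the normal unique and the metric invertible.\<close>

lemma outward_normal_in_properties:
  assumes M: "spacetime A g \<tau>" and \<Omega>: "spacelike_domain A g S \<Omega>" "S \<subseteq> \<Omega>"
    and d: "boundary_chart A S \<Omega> d" and p: "p \<in> S \<inter> fst d"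
  shows "bil (g d p) (slice3 (outward_normal_in g d p)) (slice3 (outward_normal_in g d p)) = 1"
    and "bil (g d p) (slice2 v) (slice3 (outward_normal_in g d p)) = 0"
    and "det (domain_metric g d (emb2 (surf_coord d p))) \<noteq> 0"
proof -
  have ds: "slice_chart A S d" and do: "d \<in> oriented_charts A"
    using d by (auto simp: boundary_chart_def slice_chart_def)
  have g: "lorentzian_metric A g" using M by (auto simp: spacetime_def)
  note lor = lorentzian_metricD[OF g do, of p]
  have sp: "slice3 (emb2 (surf_coord d p)) = snd d p"
    using slice2_surf_coord[OF ds p] by (simp add: slice3_emb2)
  then have emb: "emb2 (surf_coord d p) = spatial (snd d p)" by (metis spatial_slice3)
  let ?H = "domain_metric g d (emb2 (surf_coord d p))"
  have H: "bil ?H v w = bil (g d p) (slice3 v) (slice3 w)" for v w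
    unfolding domain_metric_def using pullback_slice3(1)[of "metric_coord g d" "emb2 (surf_coord d p)"] lor(2) p
      metric_coord_snd[OF oriented_charts_is_chart[OF do], of p g] by (simp add: sp)
  have pos: "bil ?H v v > 0" if "v \<noteq> 0" for v
    unfolding H using \<Omega> d p that slice3_time[of v] slice3_eq_0[of v] unfolding spacelike_domain_def by blast
  then show "det ?H \<noteq> 0" by (rule pos_def_det_nz)
  have sym: "transpose ?H = ?H"
    unfolding domain_metric_def
    by (rule transpose_pullback_metric) (use lor(1) p metric_coord_snd[OF oriented_charts_is_chart[OF do], of p g] in \<open>simp add: sp\<close>)
  let ?n = "outward_normal_in g d p"
  have n: "bil ?H ?n ?n = 1 \<and> bil ?H ?n (axis 2 1) = 0 \<and> bil ?H ?n (axis 3 1) = 0 \<and> ?n $ 1 > 0"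
    unfolding outward_normal_in_def Let_def emb[symmetric] by (rule theI'[OF unit_normal_ex1[OF pos sym]])
  then show "bil (g d p) (slice3 ?n) (slice3 ?n) = 1" by (simp add: H)
  have "bil (g d p) (slice2 v) (slice3 ?n) = bil ?H ?n (emb2 v)"
    unfolding bil_commute[OF sym, of ?n] by (simp add: H slice3_emb2)
  also have "\<dots> = 0" unfolding emb2_decompose[of v] bil_add_scaleR using n by simp
  finally show "bil (g d p) (slice2 v) (slice3 ?n) = 0" .
qed

lemma area_density_pos:
  assumes M: "spacetime A g \<tau>" and S: "spacelike_surface A g S" and c: "slice_chart A S c" and p: "p \<in> S \<inter> fst c"
  shows "det (pullback_metric (metric_coord g c) slice2 (surf_coord c p)) > 0"
proof (rule pos_def_det_2)
  have co: "c \<in> oriented_charts A" using c by (auto simp: slice_chart_def)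
  have g: "lorentzian_metric A g" using M by (auto simp: spacetime_def)
  have G: "metric_coord g c (slice2 (surf_coord c p)) = g c p"
    using slice2_surf_coord[OF c p] metric_coord_snd[OF oriented_charts_is_chart[OF co]] p by simp
  show "bil (pullback_metric (metric_coord g c) slice2 (surf_coord c p)) v v > 0" if "v \<noteq> 0" for v
  proof -
    have "bil (g c p) (slice2 v) (slice2 v) > 0"
      using S c p that slice2_time[of v] slice2_eq_0[of v] unfolding spacelike_surface_def by blast
    then show ?thesis
      using bil_pullback_metric[OF bounded_linear_imp_differentiable[OF bounded_linear_slice2]]
      by (simp add: fd_bounded_linear[OF bounded_linear_slice2] G)
  qed
  show "transpose (pullback_metric (metric_coord g c) slice2 (surf_coord c p)) =
      pullback_metric (metric_coord g c) slice2 (surf_coord c p)"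
    by (rule transpose_pullback_metric) (use lorentzian_metricD(1)[OF g co] p in \<open>simp add: G\<close>)
qed

lemma connection_form_axis:
  "connection_form g c p a b (axis m 1) = christoffel (metric_coord g c) a m b (snd c p)"
  by (simp add: connection_form_def axis_def if_distrib[where f = "\<lambda>x. _ * x"] cong: if_cong)

theorem corollary1p1:
  fixes A :: "('m::{t2_space,second_countable_topology}) chart set"
    and g :: "'m metric" and \<tau> N :: "'m vfield"
    and S \<Omega> U :: "'m set" and B :: "'m chart set"
    and \<phi> :: "'m \<Rightarrow> real^4"
  assumes "spacetime A g \<tau>"
    and "oriented_closed_surface A S B" and "spacelike_surface A g S"
    and "vector_field_along A S N"
    and "\<forall>c\<in>oriented_charts A. \<forall>p\<in>S \<inter> fst c. future_timelike g \<tau> c p (N c p)"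
    and "encloses A S \<Omega>" and "spacelike_domain A g S \<Omega>"
    and "orthogonal_to_domain A g S \<Omega> N"
    and "orientation_matches A g S B \<Omega> N"
    and "isometric_matching_reference A g \<tau> S U \<phi>"
    and "\<forall>c\<in>oriented_charts A. \<forall>p\<in>S \<inter> fst c. pushforward \<phi> c p (N c p) = axis 0 1"
    and "\<exists>t. \<phi> ` S \<subseteq> {y. y $ 0 = t}"
    and "\<forall>c\<in>oriented_charts A. \<forall>p\<in>S \<inter> fst c.
           points_outward ((spatial \<circ> \<phi>) ` S) ((spatial \<circ> \<phi>) p)
             (spatial (pushforward \<phi> c p (outward_normal A g S \<Omega> c p)))"
  shows "cnt_energy g B S N \<phi> = brown_york_mass A g B S \<Omega> (spatial \<circ> \<phi>)"
proof -
  obtain t where t: "\<phi> ` S \<subseteq> {y. y $ 0 = t}" using assms(12) by blast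
  have A: "oriented_atlas A" using assms(1) by (auto simp: spacetime_def)
  have density: "cnt_form g N \<phi> c p (axis 2 1) (axis 3 1) =
      2 * ((euclidean_mean_curvature S (spatial \<circ> \<phi>) c p - mean_curvature_in_domain A g S \<Omega> p) * area_density g c p)"
    if cB: "c \<in> B" and p: "p \<in> S \<inter> fst c" for c p
  proof -
    have c: "slice_chart A S c" using assms(2) cB by (auto simp: oriented_closed_surface_def)
    then have co: "c \<in> oriented_charts A" by (auto simp: slice_chart_def)
    \<comment> \<open>The very chart chosen in the definitions of the normal and of the mean
      curvature; that S bounds \<Omega> guarantees that such a chart exists at
      \<open>p\<close>.\<close>
    define d where "d = boundary_chart_at A S \<Omega> p"
    have "\<exists>d. boundary_chart A S \<Omega> d \<and> p \<in> fst d" using assms(6) p by (auto simp: encloses_def)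
    from someI_ex[OF this] have d: "boundary_chart A S \<Omega> d" "p \<in> fst d"
      unfolding d_def boundary_chart_at_def by simp_all
    then have ds: "slice_chart A S d" and do: "d \<in> oriented_charts A"
      by (auto simp: boundary_chart_def slice_chart_def)
    have pcd: "p \<in> S \<inter> fst c \<inter> fst d" and pd: "p \<in> S \<inter> fst d" and pf: "p \<in> fst c \<inter> fst d" using p d by auto
    define n where "n = outward_normal_in g d p"
    define \<nu> where "\<nu> = outward_normal A g S \<Omega> c p"
    note ch = oriented_charts_is_chart[OF co] oriented_charts_is_chart[OF do]
    have cp: "slice2 (surf_coord c p) = snd c p" and dp: "slice2 (surf_coord d p) = snd d p"
      using slice2_surf_coord[OF c p] slice2_surf_coord[OF ds pd] by simp_all
    have G: "metric_coord g c (snd c p) = g c p" "metric_coord g d (snd d p) = g d p"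
      using metric_coord_snd[OF ch(1)] metric_coord_snd[OF ch(2)] pf by simp_all
    interpret matched_charts "snd c ` (fst c \<inter> (fst d \<inter> U))" "snd d ` (fst d \<inter> U)" "\<lambda>y. snd d (chart_inv c y)"
      "\<phi> \<circ> chart_inv c" "\<phi> \<circ> chart_inv d" "metric_coord g c" "metric_coord g d"
      "metric_coord (pullback_minkowski \<phi>) c" "surf_coord c p" "surf_coord d p" t
      by (rule matched_charts_slice[OF assms(1,10) t c ds pcd])
    have "S \<subseteq> \<Omega>" using assms(6) by (auto simp: encloses_def)
    note n = outward_normal_in_properties[OF assms(1,7) this d(1) pd, folded n_def]
    have J: "fd (\<lambda>y. snd d (chart_inv c y)) (snd c p) v = jac c d p *v v" for v
      using jac_mult[OF A co do pf] by simp
    \<comment> \<open>In \<open>c\<close> the normal is defined by transport from \<open>d\<close>,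
      and the opposite Jacobian returns it to \<open>n\<close>.\<close>
    have \<nu>': "\<nu> = jac d c p *v slice3 n" by (simp add: \<nu>_def outward_normal_def d_def n_def Let_def)
    have J\<nu>: "jac c d p *v \<nu> = slice3 n" unfolding \<nu>' by (rule jac_inverse[OF A co do pf])
    have push: "pushforward \<phi> c p v = fd (\<phi> \<circ> chart_inv c) (snd c p) v" for v
      by (simp add: pushforward_def)
    have unit: "bil (metric_coord g d (slice2 (surf_coord d p))) (slice3 n) (slice3 n) = 1"
      and perp: "bil (metric_coord g d (slice2 (surf_coord d p))) (slice2 v) (slice3 n) = 0" for v
      using n by (simp_all add: dp G)
    have \<nu>J: "fd (\<lambda>y. snd d (chart_inv c y)) (slice2 (surf_coord c p)) \<nu> = slice3 n"
      by (simp add: cp J J\<nu>)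
    have N: "fd (\<phi> \<circ> chart_inv c) (slice2 (surf_coord c p)) (N c p) = axis 0 1"
    proof -
      have "pushforward \<phi> c p (N c p) = axis 0 1" using assms(11) co p by blast
      then show ?thesis by (simp only: push cp)
    qed
    \<comment> \<open>Orthogonality to \<Omega> is stated in boundary charts; the transformation law
      of \<open>N\<close> and the invariance of the metric bring it to \<open>c\<close>.\<close>
    have N_perp: "bil (metric_coord g c (slice2 (surf_coord c p))) (N c p) \<nu> = 0"
    proof -
      have "vector_law A S N" using assms(4) by (simp add: vector_field_along_def)
      then have "N d p = jac c d p *v N c p" using co do pcd unfolding vector_law_def by blast
      moreover have "bil (g d p) (N d p) (slice3 n) = 0"
        using assms(8) d(1) pd slice3_time unfolding orthogonal_to_domain_def by blast
      ultimately show ?thesis unfolding bil_Gc_transition by (simp add: cp dp J J\<nu> G)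
    qed
    have orient: "0 < det ((\<chi> i. if i = 0 then N c p else if i = 1 then \<nu> else axis i 1) :: real^4^4)"
      using assms(9) cB p unfolding orientation_matches_def \<nu>_def by blast
    have nondeg: "det (pullback_metric (metric_coord g d) slice3 (emb2 (surf_coord d p))) \<noteq> 0"
      using n(3) by (simp add: domain_metric_def)
    note \<sigma>_pos = area_density_pos[OF assms(1,3) c p]
    have fcp: "(spatial \<circ> (\<phi> \<circ> chart_inv c) \<circ> slice2) (surf_coord c p) = (spatial \<circ> \<phi>) p"
      using pcd is_chartD(2)[OF ch(1)] by (simp add: cp)
    have "points_outward ((spatial \<circ> \<phi>) ` S) ((spatial \<circ> (\<phi> \<circ> chart_inv c) \<circ> slice2) (surf_coord c p))
        (spatial (fd (\<phi> \<circ> chart_inv c) (slice2 (surf_coord c p)) \<nu>))"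
      using assms(13) co p unfolding fcp cp push[symmetric] \<nu>_def by blast
    note normal = fc_outward_normal[OF unit perp \<nu>J N N_perp this \<sigma>_pos]
    have k0: "euclidean_mean_curvature S (spatial \<circ> \<phi>) c p =
        mean_curvature (\<lambda>_. mat 1) (spatial \<circ> (\<phi> \<circ> chart_inv c) \<circ> slice2) (surf_coord c p)
          (spatial (fd (\<phi> \<circ> chart_inv c) (slice2 (surf_coord c p)) \<nu>))"
      unfolding euclidean_mean_curvature_def Let_def by (simp only: o_assoc[symmetric] normal[unfolded o_assoc[symmetric]])
    have k: "mean_curvature_in_domain A g S \<Omega> p =
        mean_curvature (pullback_metric (metric_coord g d) slice3) emb2 (surf_coord d p) n"
      by (simp add: mean_curvature_in_domain_def Let_def d_def n_def domain_metric_def[abs_def])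
    have "cnt_form g N \<phi> c p (axis 2 1) (axis 3 1) = (\<Sum>a\<in>UNIV. \<Sum>b\<in>UNIV.
        (christoffel (metric_coord g c) a 2 b (snd c p) - christoffel (metric_coord (pullback_minkowski \<phi>) c) a 2 b (snd c p))
          * eta_form (g c p) a b (N c p) (axis 3 1) -
        (christoffel (metric_coord g c) a 3 b (snd c p) - christoffel (metric_coord (pullback_minkowski \<phi>) c) a 3 b (snd c p))
          * eta_form (g c p) a b (N c p) (axis 2 1))"
      by (simp add: cnt_form_def wedge_def connection_form_axis)
    also have "\<dots> = 2 * (euclidean_mean_curvature S (spatial \<circ> \<phi>) c p - mean_curvature_in_domain A g S \<Omega> p) * area_density g c p"
      using cnt_density[OF unit perp \<nu>J N N_perp orient nondeg \<sigma>_pos]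
      unfolding k0 k area_density_def by (simp only: cp G)
    finally show ?thesis by simp
  qed
  \<comment> \<open>The factor 2 between the integrands turns the prefactor
    \<open>1 / (16 * pi)\<close> into \<open>1 / (8 * pi)\<close>.\<close>
  show ?thesis
    unfolding cnt_energy_def brown_york_mass_def
    using surface_integral_cong[OF assms(2) density] by (simp add: surface_integral_mult_left)
qed

end
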